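(* Let $Q=\{q(k)\}_{k\ge1}$ be a strictly increasing sequence of positive integers with $q(k+1)/q(k)\to\infty$. Then $\mathrm{PLA}+\mathcal{L}_{-Q}\neq L^0(\mathbb{T})$, i.e. there is $f\in L^0(\mathbb{T})$ that cannot be written as $f=g+h$ with $g\in\mathrm{PLA}$ and $h\in\mathcal{L}_{-Q}$.
   Context: $\mathbb{T}=\mathbb{R}/2\pi\mathbb{Z}$; $L^0(\mathbb{T})$ is the space of measurable, a.e. finite functions on $\mathbb{T}$. $\mathrm{PLA}$ denotes the set of measurable functions $g$ on $\mathbb{T}$ for which there exist complex numbers $c(n)$, $n\ge0$, such that $\sum_{0\le n<N}c(n)e^{int}\to g(t)$ as $N\to\infty$ for almost every $t$. For $S\subset\mathbb{Z}$, $\mathcal{L}_S=\{f\in L^1(\mathbb{T}):\widehat f(n)=0\ \forall n\notin S\}$, and $-Q=\{-q(k):k\ge1\}$. *)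

theory Defs
  imports "HOL-Analysis.Analysis"
begin

text \<open>The circle T = R/2piZ is modelled by the interval [0, 2pi] with Lebesgue measure;
  functions on T are functions real => complex considered on this interval
  (the identification of the endpoints is a null set).\<close>

definition circle_measure :: "real measure" where
  "circle_measure = lebesgue_on {0..2*pi}"

text \<open>L^0(T): measurable (complex-valued, hence finite) functions; equality a.e.\<close>
definition L0 :: "(real \<Rightarrow> complex) set" where
  "L0 = borel_measurable circle_measure"

definition fourier_coeff :: "(real \<Rightarrow> complex) \<Rightarrow> int \<Rightarrow> complex" where
  "fourier_coeff f n =
     (1 / (2 * pi)) * (\<integral>t. f t * exp (- \<i> * of_int n * of_real t) \<partial>circle_measure)"

definition PLA :: "(real \<Rightarrow> complex) set" where
  "PLA = {g \<in> borel_measurable circle_measure.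
            \<exists>c :: nat \<Rightarrow> complex.
              AE t in circle_measure.
                (\<lambda>N. \<Sum>n<N. c n * exp (\<i> * of_nat n * of_real t)) \<longlonglongrightarrow> g t}"

definition L_spec :: "int set \<Rightarrow> (real \<Rightarrow> complex) set" where
  "L_spec S = {f. integrable circle_measure f \<and> (\<forall>n. n \<notin> S \<longrightarrow> fourier_coeff f n = 0)}"

end

theory Submission
  imports "HOL-Complex_Analysis.Conformal_Mappings" Defs
begin

text \<open>Since \<open>q (k + 1) / q k\<close> tends to infinity, there are arbitrarily small shifts \<open>s\<close> with
  \<open>e\<^sup>i\<^sup>q\<^sup>s\<close> close to \<open>1\<close> for all \<open>q = q k\<close> simultaneously, while some \<open>n\<close> has \<open>n s\<close> near \<open>\<pi>\<close>.
  The difference operator of step \<open>s\<close> nearly annihilates every \<open>h\<close> with spectrum in \<open>-Q\<close>, at a rate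
  fixed by \<open>h\<close> alone (a Riesz product is a multiplier of bounded norm), but it
  multiplies \<open>e\<^sup>-\<^sup>i\<^sup>n\<^sup>t\<close> by a constant of modulus at least \<open>1\<close>.
  Take \<open>f\<close> to be a series of such exponentials with super-geometrically decaying coefficients \<open>\<rho>\<close>, the shifts and frequencies being chosen recursively.  If \<open>f = g + h\<close>
  with \<open>g\<close> in PLA, then \<open>e\<^sup>i\<^sup>n\<^sup>t\<close> times the difference of \<open>g\<close>, divided by \<open>\<rho>\<close>, is a one-sided series without
  constant term whose partial sums are \<open>O(1 / \<rho>)\<close> and whose sum is within \<open>O(\<rho>\<^sup>2)\<close> of a constant of
  modulus at least \<open>1\<close>, off a set of small fixed measure.  This contradicts a quantitative form of
  Privalov's uniqueness theorem, which bounds the product of the two quantities from below.\<close>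

section \<open>A quantitative Privalov theorem\<close>

text \<open>\<open>g\<close> is not assumed integrable: only almost everywhere convergence is known,
  so no Fourier coefficients of \<open>g\<close> can be compared, and the only size bound is that
  its partial sums stay below some \<open>M\<close> off a small set. Division by \<rho> turns this
  into O(1/\<rho>), so the distance to the constant must be o(\<rho>), and this fixes the exponents.
  Every error made before the division is O(\<rho>^3), which makes the product of the two quantities
  O(\<rho>). Letting each coefficient be the cube of the previous one makes the tail of
  \<open>f\<close> that small. A tolerance of \<rho>^4 for the shift leaves measure O(\<rho>) after
  Markov's inequality at height \<rho>^3, whatever the constant belonging to \<open>h\<close> is.

  The bounds for \<open>g\<close> and \<open>h\<close> become known only after \<open>f\<close> is
  fixed. Hence \<open>f\<close> carries infinitely many scales, and the scale that gives the
  contradiction is selected last.\<close>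

text \<open>The real part of \<open>l / (1 + l - z cis (-\<theta>))\<close> is an elementary substitute for the harmonic measure
  of the arc of radius \<open>l\<close> about \<open>cis \<theta>\<close>: it is positive on the disc, of size \<open>l\<close> at the origin, and bounded
  below near the arc.  Sums of such terms over a cover of the exceptional set make sawtooth domains
  unnecessary.\<close>

lemma Re_divide_of_real_shift:
  fixes w :: complex and l :: real
  shows "Re (of_real l / (of_real (1 + l) - w)) = l * (1 + l - Re w) / (norm (of_real (1 + l) - w))\<^sup>2"
  unfolding Re_divide cmod_power2 by (simp add: power2_eq_square)

lemma Re_barrier_nonneg:
  fixes w :: complex and l :: real
  assumes "l > 0" "norm w \<le> 1"
  shows "Re (of_real l / (of_real (1 + l) - w)) \<ge> 0"
  unfolding Re_divide_of_real_shift using assms complex_Re_le_cmod[of w] by (intro divide_nonneg_nonneg mult_nonneg_nonneg) auto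

lemma norm_cis_diff_le: "norm (cis x - cis y) \<le> \<bar>x - y\<bar>"
proof -
  have "cis x - cis y = cis y * (cis (x - y) - 1)"
    by (simp add: algebra_simps cis_mult)
  then have "norm (cis x - cis y) = norm (cis (x - y) - 1)"
    by (simp add: norm_mult)
  also have "\<dots> \<le> \<bar>x - y\<bar>"
    using dist_exp_i_1[of "x - y"] abs_sin_x_le_abs_x[of "(x - y) / 2"] by (simp add: cis_conv_exp)
  finally show ?thesis .
qed

lemma norm_one_minus_polar_le:
  assumes "0 \<le> \<rho>" "\<rho> \<le> 1"
  shows "norm (1 - of_real (1 - \<rho>) * cis \<phi>) \<le> \<rho> + \<bar>\<phi>\<bar>"
proof -
  have "1 - of_real (1 - \<rho>) * cis \<phi> = of_real \<rho> * cis \<phi> + (cis 0 - cis \<phi>)"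
    by (simp add: algebra_simps)
  then have "norm (1 - of_real (1 - \<rho>) * cis \<phi>) \<le> norm (of_real \<rho> * cis \<phi>) + norm (cis 0 - cis \<phi>)"
    by (metis norm_triangle_ineq)
  also have "\<dots> \<le> \<rho> + \<bar>\<phi>\<bar>"
    using norm_cis_diff_le[of 0 \<phi>] assms by (simp add: norm_mult)
  finally show ?thesis .
qed

text \<open>Put \<open>x = max l \<rho>\<close>. The factor \<open>1 + l - Re w\<close> is at least
  \<open>x\<close>, while the distance to the pole at \<open>1 + l\<close> is at most \<open>l +
  \<rho> + \<bar>t - \<theta>\<bar> \<le> 2 * l + 2 * \<rho> \<le> 4 * x\<close>; its square gives
  the 16.\<close>

lemma Re_barrier_near:
  assumes l: "l > 0" and \<rho>: "0 \<le> \<rho>" "\<rho> \<le> 1" and near: "\<bar>t - \<theta>\<bar> < \<rho> + l"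
  shows "l / (16 * max l \<rho>) \<le> Re (of_real l / (of_real (1 + l) - of_real (1 - \<rho>) * cis t * cis (-\<theta>)))"
proof -
  define w where "w = of_real (1 - \<rho>) * cis (t - \<theta>)"
  define x where "x = max l \<rho>"
  have x: "x > 0" "x \<ge> l" "x \<ge> \<rho>" using l by (auto simp: x_def)
  have w: "of_real (1 - \<rho>) * cis t * cis (-\<theta>) = w"
    by (simp add: w_def cis_mult)
  have nw: "norm w \<le> 1 - \<rho>"
    unfolding w_def norm_mult norm_of_real using \<rho> by simp
  have "Re w \<le> 1 - \<rho>" using nw complex_Re_le_cmod[of w] by linarith
  then have 1: "1 + l - Re w \<ge> x" using l \<rho> by (auto simp: x_def)
  have "norm (of_real (1 + l) - w) \<le> norm (of_real l :: complex) + norm (1 - w)"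
    by (metis (no_types, lifting) add_diff_eq norm_triangle_ineq of_real_1 of_real_add add.commute)
  also have "\<dots> \<le> l + (\<rho> + \<bar>t - \<theta>\<bar>)"
    using norm_one_minus_polar_le[OF \<rho>, of "t - \<theta>"] l by (simp add: w_def)
  also have "\<dots> \<le> 4 * x" using near x by linarith
  finally have 2: "norm (of_real (1 + l) - w) \<le> 4 * x" .
  have "Re (of_real (1 + l) - w) > 0" using 1 x by simp
  then have pos: "norm (of_real (1 + l) - w) > 0" by (metis complex_Re_le_cmod less_le_trans)
  have "l / (16 * x) = l * x / (4 * x)\<^sup>2" using x by (simp add: power2_eq_square)
  also have "\<dots> \<le> l * (1 + l - Re w) / (4 * x)\<^sup>2"
    using 1 l by (intro divide_right_mono mult_left_mono) auto
  also have "\<dots> \<le> l * (1 + l - Re w) / (norm (of_real (1 + l) - w))\<^sup>2"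
    using 1 2 l x pos by (intro divide_left_mono power_mono mult_nonneg_nonneg) auto
  finally show ?thesis unfolding w Re_divide_of_real_shift x_def .
qed

text \<open>Only balls that can meet the interval are estimated from below; all other terms are
  nonnegative. If one of these balls has radius at least \<rho>, its term alone suffices. Otherwise
  every maximum equals \<rho>, and comparing lengths shows that the radii add up to at least \<rho>.
  The contrapositive is what is used: where the barrier is small, an uncovered boundary point lies
  within \<rho> of \<open>t\<close>.\<close>

lemma Re_barrier_sum_ge:
  fixes l :: "real \<Rightarrow> real"
  assumes fin: "finite I" and l: "\<And>\<theta>. \<theta> \<in> I \<Longrightarrow> l \<theta> > 0" and \<rho>: "0 \<le> \<rho>" "\<rho> \<le> 1"
    and cov: "{t - \<rho>..t + \<rho>} \<subseteq> (\<Union>\<theta>\<in>I. ball \<theta> (l \<theta>))"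
  shows "1 / 16 \<le> Re (\<Sum>\<theta>\<in>I. of_real (l \<theta>) / (of_real (1 + l \<theta>) - of_real (1 - \<rho>) * cis t * cis (-\<theta>)))"
proof -
  define J where "J = {\<theta>\<in>I. \<bar>t - \<theta>\<bar> < \<rho> + l \<theta>}"
  have J: "finite J" "J \<subseteq> I" using fin by (auto simp: J_def)
  have covJ: "{t - \<rho>..t + \<rho>} \<subseteq> (\<Union>\<theta>\<in>J. ball \<theta> (l \<theta>))"
  proof
    fix u assume u: "u \<in> {t - \<rho>..t + \<rho>}"
    then obtain \<theta> where \<theta>: "\<theta> \<in> I" "u \<in> ball \<theta> (l \<theta>)" using cov by blast
    then have "\<theta> \<in> J" using u by (auto simp: J_def dist_real_def)
    then show "u \<in> (\<Union>\<theta>\<in>J. ball \<theta> (l \<theta>))" using \<theta> by blast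
  qed
  have "1 \<le> (\<Sum>\<theta>\<in>J. l \<theta> / max (l \<theta>) \<rho>)"
  proof (cases "\<exists>\<theta>\<in>J. l \<theta> \<ge> \<rho>")
    case True
    then obtain \<theta> where \<theta>: "\<theta> \<in> J" "l \<theta> \<ge> \<rho>" by blast
    have "1 = l \<theta> / max (l \<theta>) \<rho>" using \<theta> l[of \<theta>] J by (auto simp: max_def)
    also have "\<dots> \<le> (\<Sum>\<theta>\<in>J. l \<theta> / max (l \<theta>) \<rho>)"
      using \<theta> J l \<rho> by (intro member_le_sum) (auto intro!: divide_nonneg_nonneg simp: le_max_iff_disj less_imp_le)
    finally show ?thesis .
  next
    case False
    have "t \<in> {t - \<rho>..t + \<rho>}" using \<rho> by auto
    then obtain \<theta> where "\<theta> \<in> J" using covJ by blast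
    with False l J have \<rho>pos: "\<rho> > 0" by force
    have "2 * \<rho> = measure lborel {t - \<rho>..t + \<rho>}" using \<rho> by simp
    also have "\<dots> \<le> measure lborel (\<Union>\<theta>\<in>J. ball \<theta> (l \<theta>))"
      using covJ J by (intro measure_mono_fmeasurable fmeasurable.finite_UN)
        (auto simp: fmeasurable_def emeasure_lborel_ball_finite[unfolded infinity_ennreal_def])
    also have "\<dots> \<le> (\<Sum>\<theta>\<in>J. measure lborel (ball \<theta> (l \<theta>)))"
      using J by (intro measure_UNION_le) auto
    also have "\<dots> = (\<Sum>\<theta>\<in>J. 2 * l \<theta>)"
      using J l by (intro sum.cong refl) (auto simp: ball_eq_greaterThanLessThan less_imp_le)
    finally have "\<rho> \<le> (\<Sum>\<theta>\<in>J. l \<theta>)" by (simp flip: sum_distrib_left)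
    then have "1 \<le> (\<Sum>\<theta>\<in>J. l \<theta>) / \<rho>" using \<rho>pos by simp
    also have "\<dots> = (\<Sum>\<theta>\<in>J. l \<theta> / max (l \<theta>) \<rho>)"
      unfolding sum_divide_distrib using False by (intro sum.cong refl) (auto simp: max_def)
    finally show ?thesis .
  qed
  then have "1 / 16 \<le> (\<Sum>\<theta>\<in>J. l \<theta> / max (l \<theta>) \<rho>) / 16" by simp
  also have "\<dots> = (\<Sum>\<theta>\<in>J. l \<theta> / (16 * max (l \<theta>) \<rho>))"
    unfolding sum_divide_distrib by (simp add: mult.commute)
  also have "\<dots> \<le> (\<Sum>\<theta>\<in>J. Re (of_real (l \<theta>) / (of_real (1 + l \<theta>) - of_real (1 - \<rho>) * cis t * cis (-\<theta>))))"
    using J l \<rho> by (intro sum_mono Re_barrier_near) (auto simp: J_def)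
  also have "\<dots> \<le> (\<Sum>\<theta>\<in>I. Re (of_real (l \<theta>) / (of_real (1 + l \<theta>) - of_real (1 - \<rho>) * cis t * cis (-\<theta>))))"
  proof (intro sum_mono2 fin J)
    fix \<theta> assume "\<theta> \<in> I - J"
    then show "0 \<le> Re (of_real (l \<theta>) / (of_real (1 + l \<theta>) - of_real (1 - \<rho>) * cis t * cis (-\<theta>)))"
      using l \<rho> by (intro Re_barrier_nonneg) (simp_all only: norm_mult norm_of_real norm_cis, auto)
  qed
  finally show ?thesis by simp
qed

text \<open>The barrier at the origin is paid for by the sum of the radii, overlaps included, so a
  cover whose union is small is not enough. Vitali's lemma selects disjoint balls inside an open set
  of measure below \<mu>, where the lengths \<open>2 * r\<close> do add up, and the fivefold balls
  cover; this is the factor 5/2.\<close>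

lemma compact_finite_interval_cover:
  fixes K :: "real set"
  assumes K: "compact K" and m: "measure lebesgue K < \<mu>"
  obtains I :: "real set" and l where "finite I" "\<And>\<theta>. \<theta> \<in> I \<Longrightarrow> l \<theta> > 0"
    "K \<subseteq> (\<Union>\<theta>\<in>I. ball \<theta> (l \<theta>))" "(\<Sum>\<theta>\<in>I. l \<theta>) \<le> 5 / 2 * \<mu>"
proof -
  have lm: "K \<in> lmeasurable" using K by (rule lmeasurable_compact)
  obtain U where U0: "open U" "K \<subseteq> U" "U - K \<in> lmeasurable"
      "emeasure lebesgue (U - K) < ennreal (\<mu> - measure lebesgue K)"
    using sets_lebesgue_outer_open[of K "\<mu> - measure lebesgue K"] lm m by (auto simp: fmeasurableD)
  have mD: "measure lebesgue (U - K) < \<mu> - measure lebesgue K"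
    using U0 m by (simp add: emeasure_eq_measure2 ennreal_less_iff)
  have "U = K \<union> (U - K)" using U0 by blast
  then have U: "open U" "K \<subseteq> U" "U \<in> lmeasurable"
    using U0 lm by (blast, blast, metis fmeasurable.Un)
  have mU: "measure lebesgue U < \<mu>"
    using mD measure_Un_le[of K lebesgue "U - K"] lm U0 \<open>U = K \<union> (U - K)\<close> by (auto simp: fmeasurableD)
  have "\<exists>r. \<forall>x\<in>K. r x > 0 \<and> ball x (r x) \<subseteq> U"
    using U openE by (metis subsetD)
  then obtain r where r: "\<And>x. x \<in> K \<Longrightarrow> r x > 0" "\<And>x. x \<in> K \<Longrightarrow> ball x (r x) \<subseteq> U" by blast
  obtain T where T: "T \<subseteq> K" "finite T" "K \<subseteq> (\<Union>x\<in>T. ball x (r x))"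
  proof (rule compactE_image[OF K, of K "\<lambda>x. ball x (r x)"])
    show "K \<subseteq> (\<Union>x\<in>K. ball x (r x))" using r(1) by force
  qed auto
  obtain I where I: "I \<subseteq> T" "pairwise (\<lambda>i j. disjnt (ball i (r i)) (ball j (r j))) I"
     "K \<subseteq> (\<Union>i\<in>I. ball i (5 * r i))"
  proof (rule Vitali_covering_lemma_balls[OF T(3)])
    show "0 < r i \<and> r i \<le> (\<Sum>i\<in>T. r i)" if "i \<in> T" for i
      using that T r member_le_sum[of i T r] by (auto simp: less_imp_le subset_iff)
  qed auto
  have fI: "finite I" using I T finite_subset by blast
  have IK: "I \<subseteq> K" using I T by blast
  have "(\<Sum>i\<in>I. 2 * r i) = (\<Sum>i\<in>I. measure lebesgue (ball i (r i)))"
    using IK r by (intro sum.cong refl) (auto simp: ball_eq_greaterThanLessThan less_imp_le subset_iff)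
  also have "\<dots> = measure lebesgue (\<Union>i\<in>I. ball i (r i))"
    using I(2) by (intro measure_UNION'[symmetric] fI) (auto simp: pairwise_def)
  also have "\<dots> \<le> measure lebesgue U"
    using IK r U by (intro measure_mono_fmeasurable) (auto intro!: sets.finite_UN fI)
  finally have "(\<Sum>i\<in>I. 5 * r i) \<le> 5 / 2 * \<mu>" using mU by (simp flip: sum_distrib_left)
  then show ?thesis
    using that[of I "\<lambda>i. 5 * r i"] fI I IK r by (auto simp: subset_iff)
qed

text \<open>Summation by parts. The quotient \<open>norm (1 - x) / (1 - norm x)\<close> is the Stolz
  ratio, which is bounded when the angle of \<open>x\<close> is at most comparable to its distance
  from the circle.\<close>

lemma Abel_bound:
  fixes b :: "nat \<Rightarrow> complex"
  assumes B: "\<And>m. m \<le> N \<Longrightarrow> norm (\<Sum>n<m. b n) \<le> B" and x: "norm x < 1"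
  shows "norm (\<Sum>n<N. b n * x ^ n) \<le> B * (norm (1 - x) / (1 - norm x) + 1)"
proof -
  define S where "S m = (\<Sum>n<m. b n)" for m
  have eq: "(\<Sum>n<m. b n * x ^ n) = (\<Sum>n<m. S (Suc n) * x ^ n * (1 - x)) + S m * x ^ m" for m
    by (induction m) (auto simp: S_def algebra_simps)
  have B0: "B \<ge> 0" using B[of 0] by simp
  have "norm (\<Sum>n<N. S (Suc n) * x ^ n * (1 - x)) \<le> (\<Sum>n<N. B * norm x ^ n * norm (1 - x))"
    using B B0 by (intro sum_norm_le) (auto simp: norm_mult norm_power S_def simp del: sum.lessThan_Suc intro!: mult_right_mono)
  also have "\<dots> = B * norm (1 - x) * (\<Sum>n<N. norm x ^ n)"
    by (simp add: sum_distrib_left mult_ac)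
  also have "\<dots> \<le> B * norm (1 - x) * (1 / (1 - norm x))"
  proof (intro mult_left_mono)
    show "(\<Sum>n<N. norm x ^ n) \<le> 1 / (1 - norm x)"
      using x by (subst sum_gp_strict) (auto intro!: divide_right_mono)
  qed (use B0 in auto)
  finally have 1: "norm (\<Sum>n<N. S (Suc n) * x ^ n * (1 - x)) \<le> B * norm (1 - x) * (1 / (1 - norm x))" .
  have "norm (S N * x ^ N) \<le> B * 1"
    unfolding norm_mult norm_power using B[of N] B0 x by (intro mult_mono power_le_one) (auto simp: S_def)
  with 1 show ?thesis unfolding eq[of N]
    by (intro order_trans[OF norm_triangle_ineq]) (simp add: algebra_simps)
qed

text \<open>Let \<open>P\<close> be the polynomial with coefficients \<open>d\<close>. Then
  \<open>P - 1\<close> has modulus 1 at the origin but is small at most boundary points. The maximum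
  principle is applied to its product with \<open>exp (- a * W)\<close> on a sublevel set of
  \<open>Re W\<close>: on the part of the frontier inside the disc the exponential beats the bound
  \<open>3 * B + 1\<close> obtained from Abel summation towards a nearby good point, and on the
  circle itself \<open>P - 1\<close> is already at most \<epsilon>.\<close>

lemma quantitative_Privalov:
  fixes d :: "nat \<Rightarrow> complex"
  assumes d0: "d 0 = 0" and \<epsilon>: "0 < \<epsilon>" "\<epsilon> \<le> 1" and B: "0 < B"
    and K: "measure lebesgue {t\<in>{-1..2*pi+1}.
              (\<exists>m\<le>N. B \<le> norm (\<Sum>n<m. d n * cis t ^ n)) \<or> \<epsilon> \<le> norm ((\<Sum>n<N. d n * cis t ^ n) - 1)} < 1/200"
  shows "1 \<le> \<epsilon> * (3 * B + 1)"
proof (rule ccontr)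
  assume contra: "\<not> 1 \<le> \<epsilon> * (3 * B + 1)"
  define K where "K = {t\<in>{-1..2*pi+1}.
              (\<exists>m\<le>N. B \<le> norm (\<Sum>n<m. d n * cis t ^ n)) \<or> \<epsilon> \<le> norm ((\<Sum>n<N. d n * cis t ^ n) - 1)}"
  have contD: "continuous_on UNIV (\<lambda>t. norm (\<Sum>n<m. d n * cis t ^ n))" for m
    by (intro continuous_intros)
  have contE: "continuous_on UNIV (\<lambda>t. norm ((\<Sum>n<N. d n * cis t ^ n) - 1))"
    by (intro continuous_intros)
  have Keq: "K = {-1..2*pi+1} \<inter> ((\<Union>m\<in>{..N}. {t. B \<le> norm (\<Sum>n<m. d n * cis t ^ n)})
                \<union> {t. \<epsilon> \<le> norm ((\<Sum>n<N. d n * cis t ^ n) - 1)})"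
    by (auto simp: K_def)
  have "closed ((\<Union>m\<in>{..N}. {t. B \<le> norm (\<Sum>n<m. d n * cis t ^ n)})
                \<union> {t. \<epsilon> \<le> norm ((\<Sum>n<N. d n * cis t ^ n) - 1)})"
    by (intro closed_Un closed_UN finite_atMost ballI closed_Collect_le contD contE continuous_intros)
  then have "compact K" unfolding Keq by (intro compact_Int_closed) auto
  then obtain I l where I: "finite I" "\<And>\<theta>. \<theta> \<in> I \<Longrightarrow> l \<theta> > 0"
      "K \<subseteq> (\<Union>\<theta>\<in>I. ball \<theta> (l \<theta>))" "(\<Sum>\<theta>\<in>I. l \<theta>) \<le> 5 / 2 * (1 / 200)"
    using compact_finite_interval_cover[of K "1/200"] K unfolding K_def[symmetric] by blast
  define W where "W z = (\<Sum>\<theta>\<in>I. of_real (l \<theta>) / (of_real (1 + l \<theta>) - z * cis (-\<theta>)))" for z :: complex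
  define P where "P z = (\<Sum>n<N. d n * z ^ n)" for z
  \<comment> \<open>With this \<open>a\<close> the exponential factor equals
    \<open>\<epsilon> / (3 * B + 1)\<close> exactly where \<open>Re W = 1 / 32\<close>.\<close>
  define a where "a = 32 * ln ((3 * B + 1) / \<epsilon>)"
  define \<Psi> where "\<Psi> z = (P z - 1) * exp (- of_real a * W z)" for z
  \<comment> \<open>The level 1/32 lies below the value 1/16 forced above a fully covered interval,
    and is twice the bound 1/64 for the value at the origin.\<close>
  define S where "S = {z\<in>cball 0 1. Re (W z) \<le> 1 / 32}"
  have apos: "a > 0" unfolding a_def using B \<epsilon> by (simp add: field_simps)
  have den: "of_real (1 + l \<theta>) - z * cis (-\<theta>) \<noteq> 0" if "\<theta> \<in> I" "z \<in> cball 0 1" for \<theta> z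
  proof
    assume "of_real (1 + l \<theta>) - z * cis (-\<theta>) = 0"
    then have "norm (of_real (1 + l \<theta>) :: complex) = norm (z * cis (-\<theta>))" by simp
    then show False using that I(2)[of \<theta>] by (simp only: norm_of_real norm_mult) simp
  qed
  have holW: "W holomorphic_on cball 0 1"
    unfolding W_def using den by (intro holomorphic_intros) auto
  have hol: "\<Psi> holomorphic_on cball 0 1"
    unfolding \<Psi>_def P_def by (intro holomorphic_intros holW)
  have contW: "continuous_on (cball 0 1) (\<lambda>z. Re (W z))"
    using holW by (intro continuous_intros holomorphic_on_imp_continuous_on)
  have "closed S"
    unfolding S_def using continuous_closed_preimage[OF contW, of "{..1/32}"]
    by (simp add: vimage_def Int_def)
  have opn: "open {z\<in>ball 0 1. Re (W z) < 1 / 32}"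
    using continuous_open_preimage[OF continuous_on_subset[OF contW ball_subset_cball], of "{..<1/32}"]
    by (simp add: vimage_def Int_def)
  \<comment> \<open>The margin 1 on both sides of \<open>{0..2*pi}\<close> is there because \<rho>
    can be as large as 1: the whole interval around \<open>t\<close> then stays where the
    exceptional set is controlled.\<close>
  have good: "\<exists>u\<in>{t - \<rho>..t + \<rho>}. u \<in> {-1..2*pi+1} - K"
    if "0 \<le> \<rho>" "\<rho> \<le> 1" "0 \<le> t" "t \<le> 2 * pi" "Re (W (of_real (1 - \<rho>) * cis t)) \<le> 1 / 32" for t \<rho>
  proof (rule ccontr)
    assume n: "\<not> ?thesis"
    have "{t - \<rho>..t + \<rho>} \<subseteq> (\<Union>\<theta>\<in>I. ball \<theta> (l \<theta>))"
    proof
      fix u assume u: "u \<in> {t - \<rho>..t + \<rho>}"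
      then have "u \<in> {-1..2*pi+1}" using that by auto
      then show "u \<in> (\<Union>\<theta>\<in>I. ball \<theta> (l \<theta>))" using n u I(3) by blast
    qed
    then show False
      using Re_barrier_sum_ge[of I l \<rho> t] I(1,2) that unfolding W_def by simp
  qed
  have bd: "norm (\<Psi> z) \<le> \<epsilon>" if z: "z \<in> frontier S" for z
  proof -
    have zS: "z \<in> S" using z \<open>closed S\<close> frontier_subset_closed by blast
    then have nz: "norm z \<le> 1" and ReW: "Re (W z) \<le> 1 / 32" by (auto simp: S_def)
    define \<rho> where "\<rho> = 1 - norm z"
    have \<rho>: "0 \<le> \<rho>" "\<rho> \<le> 1" using nz by (auto simp: \<rho>_def)
    define t where "t = Arg2pi z"
    have t: "0 \<le> t" "t \<le> 2 * pi" using Arg2pi[of z] by (auto simp: t_def)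
    have zeq: "z = of_real (1 - \<rho>) * cis t"
      using Arg2pi_eq[of z] by (simp add: t_def \<rho>_def cis_conv_exp)
    obtain u where u: "u \<in> {t - \<rho>..t + \<rho>}" "u \<in> {-1..2*pi+1} - K"
      using good[OF \<rho> t] ReW zeq by metis
    have uB: "norm (\<Sum>n<m. d n * cis u ^ n) \<le> B" if "m \<le> N" for m
      using u that unfolding K_def by (auto simp: not_le dest!: spec[of _ m])
    have uE: "norm ((\<Sum>n<N. d n * cis u ^ n) - 1) \<le> \<epsilon>"
      using u unfolding K_def by (auto simp: not_le intro: less_imp_le)
    have ReW0: "0 \<le> Re (W z)"
      unfolding W_def Re_sum using nz I(2) by (intro sum_nonneg Re_barrier_nonneg) (auto simp: norm_mult)
    show ?thesis
    proof (cases "norm z = 1")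
      case True
      then have "u = t" using u by (simp add: \<rho>_def)
      then have "P z - 1 = (\<Sum>n<N. d n * cis u ^ n) - 1" using zeq True by (simp add: P_def \<rho>_def)
      then have "norm (P z - 1) \<le> \<epsilon>" using uE by simp
      moreover have "norm (exp (- of_real a * W z)) \<le> 1" using apos ReW0 by simp
      ultimately show ?thesis
        unfolding \<Psi>_def norm_mult using \<epsilon> mult_mono[of "norm (P z - 1)" \<epsilon> "norm (exp (- of_real a * W z))" 1] by simp
    next
      case False
      then have nz1: "norm z < 1" using nz by simp
      have ReWeq: "Re (W z) = 1 / 32"
      proof (rule ccontr)
        assume "Re (W z) \<noteq> 1 / 32"
        then have "z \<in> {z\<in>ball 0 1. Re (W z) < 1 / 32}" using ReW nz1 by simp
        moreover have "{z\<in>ball 0 1. Re (W z) < 1 / 32} \<subseteq> S" by (auto simp: S_def)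
        ultimately have "z \<in> interior S" using opn by (meson interiorI)
        then show False using z by (simp add: frontier_def)
      qed
      define x where "x = of_real (1 - \<rho>) * cis (t - u)"
      have nx: "norm x = 1 - \<rho>" unfolding x_def norm_mult norm_of_real using \<rho> by simp
      have \<rho>0: "\<rho> > 0" using nz1 by (simp add: \<rho>_def)
      have zx: "z = cis u * x" unfolding zeq x_def by (simp add: cis_mult mult.left_commute)
      have "norm (P z) = norm (\<Sum>n<N. (d n * cis u ^ n) * x ^ n)"
        unfolding P_def zx by (simp add: power_mult_distrib mult.assoc)
      also have "\<dots> \<le> B * (norm (1 - x) / (1 - norm x) + 1)"
        using uB nx \<rho>0 by (intro Abel_bound) auto
      also have "\<dots> \<le> B * (2 + 1)"
      proof (intro mult_left_mono add_right_mono)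
        have "norm (1 - x) \<le> \<rho> + \<bar>t - u\<bar>" unfolding x_def by (rule norm_one_minus_polar_le[OF \<rho>])
        also have "\<dots> \<le> 2 * \<rho>" using u by auto
        finally show "norm (1 - x) / (1 - norm x) \<le> 2" using nx \<rho>0 by (simp add: field_simps)
      qed (use B in auto)
      finally have "norm (P z - 1) \<le> 3 * B + 1"
        using norm_triangle_ineq4[of "P z" 1] by simp
      moreover have "norm (exp (- of_real a * W z)) = \<epsilon> / (3 * B + 1)"
      proof -
        have "norm (exp (- of_real a * W z)) = exp (- ln ((3 * B + 1) / \<epsilon>))"
          using ReWeq by (simp add: a_def)
        also have "\<dots> = \<epsilon> / (3 * B + 1)" using B \<epsilon> by (simp add: exp_minus)
        finally show ?thesis .
      qed
      ultimately have "norm (\<Psi> z) \<le> (3 * B + 1) * (\<epsilon> / (3 * B + 1))"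
        unfolding \<Psi>_def norm_mult using B \<epsilon> by (intro mult_mono) auto
      then show ?thesis using B by simp
    qed
  qed
  have W0: "W 0 = of_real (\<Sum>\<theta>\<in>I. l \<theta> / (1 + l \<theta>))" by (simp add: W_def)
  \<comment> \<open>The radii sum to at most \<open>5 / 2 * (1 / 200) = 1 / 80\<close>.\<close>
  have W0le: "(\<Sum>\<theta>\<in>I. l \<theta> / (1 + l \<theta>)) \<le> 1 / 64"
  proof -
    have "(\<Sum>\<theta>\<in>I. l \<theta> / (1 + l \<theta>)) \<le> (\<Sum>\<theta>\<in>I. l \<theta>)"
      using I(2) by (intro sum_mono) (auto simp: field_simps dest!: I(2))
    then show ?thesis using I(4) by simp
  qed
  have "norm (\<Psi> 0) \<le> \<epsilon>"
  proof (rule maximum_modulus_frontier[of \<Psi> S])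
    show "\<Psi> holomorphic_on interior S"
      by (rule holomorphic_on_subset[OF hol]) (use interior_subset[of S] in \<open>auto simp: S_def\<close>)
    show "continuous_on (closure S) \<Psi>"
      by (rule continuous_on_subset[OF holomorphic_on_imp_continuous_on[OF hol]])
        (use \<open>closed S\<close> in \<open>auto simp: S_def\<close>)
    show "bounded S" by (rule bounded_subset[of "cball 0 1"]) (auto simp: S_def)
    show "0 \<in> S" using W0 W0le by (simp add: S_def)
  qed (use bd in auto)
  have P0: "P 0 = 0"
  proof -
    have "P 0 = (\<Sum>n<N. 0)" unfolding P_def using d0 by (intro sum.cong refl) (auto simp: power_0_left)
    then show ?thesis by simp
  qed
  \<comment> \<open>At the origin the exponent is at most \<open>32 / 64 = 1 / 2\<close> of the
    logarithm, so only the square root of \<open>\<epsilon> / (3 * B + 1)\<close> is lost there.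
    Squaring the inequality from the maximum principle then leaves one spare factor
    \<epsilon>.\<close>
  have "exp (- (1/2) * ln ((3 * B + 1) / \<epsilon>)) \<le> exp (- (a * (\<Sum>\<theta>\<in>I. l \<theta> / (1 + l \<theta>))))"
  proof -
    have "a * (\<Sum>\<theta>\<in>I. l \<theta> / (1 + l \<theta>)) \<le> a * (1 / 64)"
      using W0le apos by (intro mult_left_mono) auto
    then show ?thesis unfolding a_def by simp
  qed
  also have "\<dots> = norm (\<Psi> 0)" unfolding \<Psi>_def P0 W0 norm_mult by simp
  also have "\<dots> \<le> \<epsilon>" by fact
  finally have "(exp (- (1/2) * ln ((3 * B + 1) / \<epsilon>)))\<^sup>2 \<le> \<epsilon>\<^sup>2" by (intro power_mono) auto
  moreover have "(exp (- (1/2) * ln ((3 * B + 1) / \<epsilon>)))\<^sup>2 = exp (- ln ((3 * B + 1) / \<epsilon>))"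
    by (simp add: power2_eq_square flip: exp_add)
  moreover have "exp (- ln ((3 * B + 1) / \<epsilon>)) = \<epsilon> / (3 * B + 1)" using B \<epsilon> by (simp add: exp_minus)
  ultimately have "\<epsilon> / (3 * B + 1) \<le> \<epsilon>\<^sup>2" by simp
  then have "\<epsilon> * 1 \<le> \<epsilon> * (\<epsilon> * (3 * B + 1))" using B \<epsilon> by (simp add: field_simps power2_eq_square)
  then have "1 \<le> \<epsilon> * (3 * B + 1)" using \<epsilon> by (simp only: mult_le_cancel_left_pos)
  with contra show False by simp
qed

section \<open>The norm of an integrable function by duality with trigonometric polynomials\<close>

lemma space_circle_measure [simp]: "space circle_measure = {0..2*pi}"
  by (simp add: circle_measure_def)

lemma finite_measure_circle_measure: "finite_measure circle_measure"
  unfolding circle_measure_def by (intro finite_measure_lebesgue_on) auto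

lemma integrable_circle_continuous:
  fixes \<phi> :: "real \<Rightarrow> complex"
  assumes "continuous_on {0..2*pi} \<phi>"
  shows "integrable circle_measure \<phi>"
  unfolding circle_measure_def using assms
  by (metis absolutely_integrable_continuous_real absolutely_integrable_imp_integrable fmeasurableD lmeasurable_interval(1) box_real(2) lmeasurable_cbox)

lemma integrable_circle_times_continuous:
  fixes \<phi> v :: "real \<Rightarrow> complex"
  assumes v: "integrable circle_measure v" and \<phi>: "continuous_on {0..2*pi} \<phi>"
  shows "integrable circle_measure (\<lambda>t. v t * \<phi> t)"
proof -
  have m: "\<phi> \<in> borel_measurable circle_measure"
    using integrable_circle_continuous[OF \<phi>] by (rule borel_measurable_integrable)
  have "compact (\<phi> ` {0..2*pi})" using \<phi> by (intro compact_continuous_image) auto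
  then obtain B where B: "\<And>t. t \<in> {0..2*pi} \<Longrightarrow> norm (\<phi> t) \<le> B"
    by (meson compact_imp_bounded bounded_iff imageI)
  show ?thesis
  proof (rule Bochner_Integration.integrable_bound)
    show "integrable circle_measure (\<lambda>t. B * norm (v t))" using v by auto
    show "(\<lambda>t. v t * \<phi> t) \<in> borel_measurable circle_measure" using m v by measurable
    show "AE t in circle_measure. norm (v t * \<phi> t) \<le> norm (B * norm (v t))"
    proof (rule AE_I2)
      fix t assume "t \<in> space circle_measure"
      then have "norm (\<phi> t) \<le> \<bar>B\<bar>" using B[of t] by auto
      then show "norm (v t * \<phi> t) \<le> norm (B * norm (v t))"
        using mult_left_mono[of "norm (\<phi> t)" "\<bar>B\<bar>" "norm (v t)"] by (simp add: norm_mult abs_mult mult_ac)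
    qed
  qed
qed

text \<open>An inductive closure instead of an explicit finite sum makes products a double
  induction; \<open>trig_poly_expansion\<close> recovers the sum over distinct frequencies.\<close>

inductive trig_poly :: "(real \<Rightarrow> complex) \<Rightarrow> bool" where
  monom: "trig_poly (\<lambda>t. a * cis (of_int n * t))"
| add: "trig_poly f \<Longrightarrow> trig_poly g \<Longrightarrow> trig_poly (\<lambda>t. f t + g t)"

lemma trig_poly_const: "trig_poly (\<lambda>t. a)"
  using trig_poly.monom[of a 0] by simp

lemma trig_poly_mult:
  assumes "trig_poly f" "trig_poly g"
  shows "trig_poly (\<lambda>t. f t * g t)"
  using assms
proof (induction f rule: trig_poly.induct)
  case (monom a n)
  from monom.prems show ?case
  proof (induction g rule: trig_poly.induct)
    case (monom b m)
    have "(\<lambda>t. a * cis (of_int n * t) * (b * cis (of_int m * t))) = (\<lambda>t. (a * b) * cis (of_int (n + m) * t))"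
      by (auto simp: distrib_right simp flip: cis_mult)
    then show ?case using trig_poly.monom[of "a * b" "n + m"] by simp
  qed (simp add: distrib_left trig_poly.add)
qed (simp add: distrib_right trig_poly.add)

lemma trig_poly_expansion:
  assumes "trig_poly f"
  obtains A :: "int set" and c where "finite A" "f = (\<lambda>t. \<Sum>n\<in>A. c n * cis (of_int n * t))"
proof -
  have "\<exists>A c. finite A \<and> f = (\<lambda>t. \<Sum>n\<in>A. c n * cis (of_int n * t))"
    using assms
  proof induction
    case (monom a n)
    show ?case by (rule exI[of _ "{n}"], rule exI[of _ "\<lambda>_. a"]) simp
  next
    case (add f g)
    then obtain A c B d where AB: "finite A" "f = (\<lambda>t. \<Sum>n\<in>A. c n * cis (of_int n * t))"
      "finite B" "g = (\<lambda>t. \<Sum>n\<in>B. d n * cis (of_int n * t))" by blast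
    define e where "e n = (if n \<in> A then c n else 0) + (if n \<in> B then d n else 0)" for n
    have "f t + g t = (\<Sum>n\<in>A \<union> B. e n * cis (of_int n * t))" for t
    proof -
      have "f t = (\<Sum>n\<in>A \<union> B. (if n \<in> A then c n else 0) * cis (of_int n * t))"
        unfolding AB(2) using AB by (intro sum.mono_neutral_cong_left) auto
      moreover have "g t = (\<Sum>n\<in>A \<union> B. (if n \<in> B then d n else 0) * cis (of_int n * t))"
        unfolding AB(4) using AB by (intro sum.mono_neutral_cong_left) auto
      ultimately show ?thesis by (simp add: e_def distrib_right sum.distrib)
    qed
    then show ?case using AB by blast
  qed
  then show ?thesis using that by blast
qed

text \<open>The linear case is the only one with content: \<open>p\<close> is merely real linear, so
  \<open>p (cis t)\<close> is a combination of \<open>cos t\<close> and \<open>sin t\<close> and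
  involves both frequencies 1 and -1.\<close>

lemma trig_poly_real_polynomial_cis:
  fixes p :: "complex \<Rightarrow> real"
  assumes "real_polynomial_function p"
  shows "trig_poly (\<lambda>t. of_real (p (cis t)))"
  using assms
proof induction
  case (linear p)
  have "trig_poly (\<lambda>t. (of_real (p 1) / 2 + of_real (p \<i>) / (2 * \<i>)) * cis (of_int 1 * t) +
           (of_real (p 1) / 2 - of_real (p \<i>) / (2 * \<i>)) * cis (of_int (-1) * t))"
    by (intro trig_poly.intros)
  moreover have "(of_real (p 1) / 2 + of_real (p \<i>) / (2 * \<i>)) * cis (of_int 1 * t) +
           (of_real (p 1) / 2 - of_real (p \<i>) / (2 * \<i>)) * cis (of_int (-1) * t) = of_real (p (cis t))" for t
  proof -
    interpret bounded_linear p by fact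
    have "cis t = cos t *\<^sub>R 1 + sin t *\<^sub>R \<i>" by (simp add: complex_eq_iff)
    then have "p (cis t) = cos t * p 1 + sin t * p \<i>" by (simp only: add scaleR) simp
    then show ?thesis by (simp add: complex_eq_iff)
  qed
  ultimately show ?case by simp
qed (auto intro: trig_poly_const trig_poly.add trig_poly_mult)

lemma trig_poly_polynomial_function_cis:
  fixes p :: "complex \<Rightarrow> complex"
  assumes "polynomial_function p"
  shows "trig_poly (\<lambda>t. p (cis t))"
proof -
  have "trig_poly (\<lambda>t. of_real ((Re \<circ> p) (cis t)) + \<i> * of_real ((Im \<circ> p) (cis t)))"
    using assms bounded_linear_Re bounded_linear_Im unfolding polynomial_function_def
    by (intro trig_poly.add trig_poly_mult trig_poly_const trig_poly_real_polynomial_cis) blast+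
  then show ?thesis by (simp flip: complex_eq)
qed

lemma trig_poly_continuous: "trig_poly f \<Longrightarrow> continuous_on S f"
  by (induction rule: trig_poly.induct) (auto intro!: continuous_intros)

text \<open>Continuous functions on the circle are obtained from functions of the angle by multiplying with a
  factor that vanishes at \<open>1\<close>, where \<open>Arg2pi\<close> jumps.\<close>

lemma continuous_on_sphere_Arg2pi:
  fixes g :: "real \<Rightarrow> complex"
  assumes g: "continuous_on UNIV g" and b: "\<And>t. norm (g t) \<le> 1"
  shows "continuous_on (sphere 0 1) (\<lambda>z. g (Arg2pi z) * of_real (min 1 (real n * norm (z - 1))))"
proof -
  have "isCont (\<lambda>z. g (Arg2pi z) * of_real (min 1 (real n * norm (z - 1)))) z" if z: "z \<in> sphere 0 1" for z
  proof (cases "z = 1")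
    case True
    have "((\<lambda>z. g (Arg2pi z) * of_real (min 1 (real n * norm (z - 1)))) \<longlongrightarrow> 0) (at 1)"
    proof (rule tendsto_0_le[where K = 1])
      show "((\<lambda>z::complex. min 1 (real n * norm (z - 1))) \<longlongrightarrow> 0) (at 1)"
        by (rule tendsto_eq_intros refl | simp)+
      show "\<forall>\<^sub>F z in at 1. norm (g (Arg2pi z) * of_real (min 1 (real n * norm (z - 1))))
          \<le> norm (min 1 (real n * norm (z - 1))) * 1"
        unfolding norm_mult using b by (intro always_eventually allI) (simp add: mult_left_le_one_le del: min.bounded_iff)
    qed
    then show ?thesis using True by (simp add: isCont_def)
  next
    case False
    have "z \<notin> \<real>\<^sub>\<ge>\<^sub>0"
    proof
      assume "z \<in> \<real>\<^sub>\<ge>\<^sub>0"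
      then obtain r where "z = of_real r" "r \<ge> 0" by (auto simp: nonneg_Reals_def)
      then show False using z False by simp
    qed
    then have "isCont Arg2pi z" by (rule continuous_at_Arg2pi)
    moreover have "isCont g (Arg2pi z)" using g by (simp add: continuous_on_eq_continuous_at)
    ultimately have "isCont (\<lambda>z. g (Arg2pi z)) z" by (rule isCont_o2)
    then show ?thesis by (intro continuous_intros)
  qed
  then show ?thesis by (auto simp: continuous_on_eq_continuous_within intro: continuous_at_imp_continuous_at_within)
qed

text \<open>The differences of \<open>h\<close> are accessible only through their Fourier
  coefficients, so the norm must be computed from tests that see finitely many of them. The optimal
  test is the conjugate phase \<open>w\<close> of \<open>v\<close>. It is the almost everywhere
  limit of trigonometric polynomials of sup norm at most 2, and their bounds tend to 1; dominated
  convergence does the rest.\<close>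

lemma L1_norm_le_trig_poly_test:
  fixes v :: "real \<Rightarrow> complex"
  assumes v: "integrable circle_measure v" 
    and test: "\<And>\<phi>. trig_poly \<phi> \<Longrightarrow> (\<And>t. norm (\<phi> t) \<le> 1) \<Longrightarrow> norm (\<integral>t. v t * \<phi> t \<partial>circle_measure) \<le> C"
  shows "(\<integral>t. norm (v t) \<partial>circle_measure) \<le> C"
proof -
  define w where "w t = cnj (v t) / of_real (norm (v t))" for t
  have wm: "w \<in> borel_measurable circle_measure"
    unfolding w_def using v by (intro borel_measurable_divide borel_measurable_continuous_on[OF continuous_on_cnj[OF continuous_on_id]]) auto
  have vw: "v t * w t = of_real (norm (v t))" for t
    unfolding w_def using complex_norm_square[of "v t"] by (cases "v t = 0") (auto simp: power2_eq_square field_simps)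
  have w1: "norm (w t) \<le> 1" for t unfolding w_def by (cases "v t = 0") (auto simp: norm_divide)
  have "w measurable_on {0..2*pi}"
    using wm by (subst measurable_on_iff_borel_measurable) (auto simp: circle_measure_def)
  then obtain N g where N: "negligible N" and g: "\<And>n. continuous_on UNIV (g n)"
    and lim: "\<And>x. x \<notin> N \<Longrightarrow> (\<lambda>n. g n x) \<longlonglongrightarrow> (if x \<in> {0..2*pi} then w x else 0)"
    unfolding measurable_on_def by blast
  \<comment> \<open>Measurability yields continuous approximants \<open>g n\<close> without any
    uniform bound. Retracting them onto the unit disc supplies one and, since \<open>w\<close> lies
    in the disc, keeps the limit.\<close>
  define clip :: "complex \<Rightarrow> complex" where "clip z = z / of_real (max 1 (norm z))" for z
  have clip_cont: "continuous_on UNIV clip"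
    unfolding clip_def by (intro continuous_intros) auto
  have clip1: "norm (clip z) \<le> 1" for z by (auto simp: clip_def norm_divide max_def field_simps)
  have clip_id: "clip z = z" if "norm z \<le> 1" for z using that by (auto simp: clip_def max_def)
  define \<Phi> where "\<Phi> n z = clip (g n (Arg2pi z)) * of_real (min 1 (real n * norm (z - 1)))" for n z
  have \<Phi>1: "norm (\<Phi> n z) \<le> 1" for n z
    unfolding \<Phi>_def norm_mult using clip1 by (intro mult_le_one) auto
  have "\<exists>p. polynomial_function p \<and> (\<forall>z\<in>sphere 0 1. norm (\<Phi> n z - p z) < 1 / real (Suc n))" for n
  proof (rule Stone_Weierstrass_polynomial_function)
    show "continuous_on (sphere 0 1) (\<Phi> n)"
      unfolding \<Phi>_def
      by (rule continuous_on_sphere_Arg2pi[where g = "\<lambda>t. clip (g n t)"])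
         (auto simp: clip1 intro: continuous_on_compose2[OF clip_cont g])
  qed auto
  then obtain p where p: "\<And>n. polynomial_function (p n)"
     "\<And>n z. z \<in> sphere 0 1 \<Longrightarrow> norm (\<Phi> n z - p n z) < 1 / real (Suc n)" by metis
  define \<phi> where "\<phi> n t = p n (cis t)" for n t
  have tp: "trig_poly (\<phi> n)" for n unfolding \<phi>_def by (rule trig_poly_polynomial_function_cis[OF p(1)])
  \<comment> \<open>The approximation error may push the sup norm above 1; dividing by
    \<open>b n\<close>, which tends to 1, makes the polynomial an admissible test.\<close>
  define b where "b n = 1 + 1 / real (Suc n)" for n
  have b: "b n > 0" "b n \<le> 2" for n by (auto simp: b_def field_simps add_pos_nonneg)
  have \<phi>b: "norm (\<phi> n t) \<le> b n" for n t
    using p(2)[of "cis t" n] \<Phi>1[of n "cis t"] norm_triangle_ineq2[of "p n (cis t)" "\<Phi> n (cis t)"]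
    by (simp add: \<phi>_def b_def norm_minus_commute)
  have bound: "norm (\<integral>t. v t * \<phi> n t \<partial>circle_measure) \<le> C * b n" for n
  proof -
    have "norm (\<integral>t. v t * (\<phi> n t * of_real (1 / b n)) \<partial>circle_measure) \<le> C"
    proof (intro test trig_poly_mult tp trig_poly_const)
      show "norm (\<phi> n t * of_real (1 / b n)) \<le> 1" for t
        unfolding norm_mult norm_of_real using \<phi>b[of n t] b[of n] by (simp add: field_simps)
    qed
    moreover have "(\<integral>t. v t * (\<phi> n t * of_real (1 / b n)) \<partial>circle_measure)
        = (\<integral>t. v t * \<phi> n t \<partial>circle_measure) * of_real (1 / b n)"
      by (simp flip: mult.assoc)
    ultimately show ?thesis using b[of n] by (simp add: norm_mult norm_divide field_simps)
  qed
  \<comment> \<open>Both endpoints are discarded: the cutoff vanishes at them, and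
    \<open>Arg2pi\<close> sends \<open>cis (2 * pi)\<close> to 0.\<close>
  have conv: "AE t in circle_measure. (\<lambda>n. v t * \<phi> n t) \<longlonglongrightarrow> v t * w t"
  proof -
    have "AE t in lebesgue. t \<notin> N \<union> {0, 2*pi}"
      using N by (intro AE_not_in) (auto simp: negligible_iff_null_sets[symmetric])
    then have "AE t in circle_measure. t \<notin> N \<union> {0, 2*pi}"
      unfolding circle_measure_def by (subst AE_restrict_space_iff) auto
    then show ?thesis
    proof (rule AE_mp[OF _ AE_I2], intro impI)
      fix t assume t: "t \<in> space circle_measure" "t \<notin> N \<union> {0, 2*pi}"
      have arg: "Arg2pi (cis t) = t" using t by (intro Arg2pi_unique[of 1]) (auto simp: cis_conv_exp)
      have ne: "cis t \<noteq> 1"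
      proof
        assume "cis t = 1"
        moreover have "Arg2pi 1 = 0" using Arg2pi_of_real[of 1] by simp
        ultimately show False using arg t by simp
      qed
      have "(\<lambda>n. clip (g n t)) \<longlonglongrightarrow> clip (w t)"
      proof (rule isCont_tendsto_compose[where g = clip])
        show "isCont clip (w t)" using clip_cont by (simp add: continuous_on_eq_continuous_at)
        show "(\<lambda>n. g n t) \<longlonglongrightarrow> w t" using lim[of t] t by auto
      qed
      moreover have "(\<lambda>n. complex_of_real (min 1 (real n * norm (cis t - 1)))) \<longlonglongrightarrow> of_real 1"
      proof (intro tendsto_of_real tendsto_eventually)
        obtain k where k: "1 \<le> real k * norm (cis t - 1)"
          using real_arch_simple[of "1 / norm (cis t - 1)"] ne by (auto simp: field_simps)
        show "\<forall>\<^sub>F n in sequentially. min 1 (real n * norm (cis t - 1)) = 1"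
          using eventually_ge_at_top[of k]
        proof eventually_elim
          case (elim n)
          have "real k * norm (cis t - 1) \<le> real n * norm (cis t - 1)" using elim by (intro mult_right_mono) auto
          then show ?case using k by simp
        qed
      qed
      ultimately have "(\<lambda>n. \<Phi> n (cis t)) \<longlonglongrightarrow> clip (w t) * of_real 1"
        unfolding \<Phi>_def arg by (rule tendsto_mult)
      then have 1: "(\<lambda>n. \<Phi> n (cis t)) \<longlonglongrightarrow> w t" by (simp add: clip_id w1)
      have 2: "(\<lambda>n. \<phi> n t - \<Phi> n (cis t)) \<longlonglongrightarrow> 0"
      proof (rule Lim_null_comparison)
        show "\<forall>\<^sub>F n in sequentially. norm (\<phi> n t - \<Phi> n (cis t)) \<le> inverse (real (Suc n))"
          using p(2)[of "cis t"] by (intro always_eventually allI) (simp add: \<phi>_def norm_minus_commute less_imp_le inverse_eq_divide)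
      qed (rule LIMSEQ_inverse_real_of_nat)
      have "(\<lambda>n. \<phi> n t) \<longlonglongrightarrow> w t" using tendsto_add[OF 2 1] by simp
      then show "(\<lambda>n. v t * \<phi> n t) \<longlonglongrightarrow> v t * w t" by (intro tendsto_intros)
    qed
  qed
  have "(\<lambda>n. \<integral>t. v t * \<phi> n t \<partial>circle_measure) \<longlonglongrightarrow> (\<integral>t. v t * w t \<partial>circle_measure)"
  proof (rule integral_dominated_convergence[where w = "\<lambda>t. 2 * norm (v t)"])
    show "(\<lambda>t. v t * w t) \<in> borel_measurable circle_measure" using wm v by measurable
    show "(\<lambda>t. v t * \<phi> n t) \<in> borel_measurable circle_measure" for n
      using integrable_circle_times_continuous[OF v trig_poly_continuous[OF tp]]
      by (rule borel_measurable_integrable)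
    show "AE t in circle_measure. norm (v t * \<phi> n t) \<le> 2 * norm (v t)" for n
    proof (rule AE_I2)
      fix t
      show "norm (v t * \<phi> n t) \<le> 2 * norm (v t)"
        using mult_left_mono[OF order_trans[OF \<phi>b[of n t] b(2)[of n]], of "norm (v t)"] by (simp add: norm_mult mult_ac)
    qed
  qed (use v conv in auto)
  then have 1: "(\<lambda>n. norm (\<integral>t. v t * \<phi> n t \<partial>circle_measure)) \<longlonglongrightarrow> norm (\<integral>t. v t * w t \<partial>circle_measure)"
    by (rule tendsto_norm)
  have "(\<lambda>n. 1 + inverse (real (Suc n))) \<longlonglongrightarrow> 1 + 0" by (intro tendsto_intros LIMSEQ_inverse_real_of_nat)
  then have "b \<longlonglongrightarrow> 1" by (simp add: b_def[abs_def] inverse_eq_divide)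
  then have 2: "(\<lambda>n. C * b n) \<longlonglongrightarrow> C * 1" by (intro tendsto_intros)
  have "norm (\<integral>t. v t * w t \<partial>circle_measure) \<le> C"
    using LIMSEQ_le[OF 1 2] bound by auto
  moreover have "(\<integral>t. v t * w t \<partial>circle_measure) = of_real (\<integral>t. norm (v t) \<partial>circle_measure)"
    unfolding vw by simp
  ultimately show ?thesis by simp
qed

section \<open>Riesz products\<close>

lemma exp_frequency_eq_cis:
  "exp (- \<i> * of_int n * of_real t) = cis (of_int (- n) * t)"
  "exp (\<i> * of_nat m * of_real t) = cis t ^ m"
  by (simp_all add: cis_conv_exp mult_ac flip: exp_of_nat_mult)

lemma fourier_coeff_eq:
  "(\<integral>t. f t * cis (of_int n * t) \<partial>circle_measure) = 2 * pi * fourier_coeff f (- n)"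
  unfolding fourier_coeff_def exp_frequency_eq_cis by simp

lemma integrable_circle_times_cis:
  "integrable circle_measure f \<Longrightarrow> integrable circle_measure (\<lambda>t. f t * cis (a * t))"
  by (rule integrable_circle_times_continuous) (auto intro!: continuous_intros)

lemma integrable_circle_cis: "integrable circle_measure (\<lambda>t. c * cis (a * t))"
  by (rule integrable_circle_continuous) (auto intro!: continuous_intros)

lemma integral_circle_cis:
  "(\<integral>t. cis (of_int n * t) \<partial>circle_measure) = (if n = 0 then 2 * pi else 0)"
proof (cases "n = 0")
  case True
  then show ?thesis by (simp add: circle_measure_def measure_restrict_space scaleR_conv_of_real)
next
  case False
  have "((\<lambda>t. cis (of_int n * t)) has_integral
      cis (of_int n * (2 * pi)) / (\<i> * of_int n) - cis (of_int n * 0) / (\<i> * of_int n)) {0..2*pi}"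
  proof (rule fundamental_theorem_of_calculus)
    fix t
    show "((\<lambda>t. cis (of_int n * t) / (\<i> * of_int n)) has_vector_derivative cis (of_int n * t)) (at t within {0..2*pi})"
      unfolding cis_conv_exp using False
      by (auto intro!: derivative_eq_intros has_vector_derivative_real_field simp: scaleR_conv_of_real field_simps)
  qed auto
  moreover have "cis (of_int n * (2 * pi)) = 1"
    using cis_multiple_2pi[of "of_int n"] by (simp add: mult_ac)
  ultimately have "integral {0..2*pi} (\<lambda>t. cis (of_int n * t)) = 0" by (simp add: integral_unique)
  then show ?thesis
    using False integrable_circle_cis[of 1 "of_int n"]
    by (simp add: circle_measure_def lebesgue_integral_eq_integral)
qed

lemma fourier_coeff_cis:
  "fourier_coeff (\<lambda>t. c * cis (of_int m * t)) n = (if m = n then c else 0)"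
proof -
  have "(\<integral>t. c * cis (of_int m * t) * cis (of_int (- n) * t) \<partial>circle_measure)
      = (\<integral>t. c * cis (of_int (m - n) * t) \<partial>circle_measure)"
    by (intro Bochner_Integration.integral_cong refl) (simp add: mult.assoc cis_mult left_diff_distrib)
  then show ?thesis
    using integral_circle_cis[of "m - n"] fourier_coeff_eq[of "\<lambda>t. c * cis (of_int m * t)" "- n"]
    by (auto split: if_splits)
qed

lemma fourier_coeff_add:
  assumes "integrable circle_measure f" "integrable circle_measure g"
  shows "fourier_coeff (\<lambda>t. f t + g t) n = fourier_coeff f n + fourier_coeff g n"
  using assms unfolding fourier_coeff_def exp_frequency_eq_cis distrib_right
  by (subst Bochner_Integration.integral_add) (auto simp: distrib_left intro: integrable_circle_times_cis simp del: of_int_minus)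

lemma fourier_coeff_diff:
  assumes "integrable circle_measure f" "integrable circle_measure g"
  shows "fourier_coeff (\<lambda>t. f t - g t) n = fourier_coeff f n - fourier_coeff g n"
  using assms unfolding fourier_coeff_def exp_frequency_eq_cis left_diff_distrib
  by (subst Bochner_Integration.integral_diff) (auto simp: right_diff_distrib intro: integrable_circle_times_cis simp del: of_int_minus)

lemma fourier_coeff_sum:
  assumes "\<And>i. i \<in> A \<Longrightarrow> integrable circle_measure (f i)"
  shows "fourier_coeff (\<lambda>t. \<Sum>i\<in>A. f i t) n = (\<Sum>i\<in>A. fourier_coeff (f i) n)"
  using assms unfolding fourier_coeff_def exp_frequency_eq_cis sum_distrib_right
  by (subst Bochner_Integration.integral_sum) (auto simp: sum_distrib_left intro: integrable_circle_times_cis simp del: of_int_minus)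

lemma fourier_coeff_times_cis:
  "fourier_coeff (\<lambda>t. f t * (c * cis (of_int m * t))) n = c * fourier_coeff f (n - m)"
proof -
  have "(\<lambda>t. f t * (c * cis (of_int m * t)) * cis (of_int (- n) * t)) = (\<lambda>t. c * (f t * cis (of_int (- (n - m)) * t)))"
    by (auto simp: fun_eq_iff mult_ac left_diff_distrib right_diff_distrib cis_mult intro!: arg_cong[where f = "\<lambda>x. _ * (_ * x)"])
  then show ?thesis unfolding fourier_coeff_def exp_frequency_eq_cis by (simp only: integral_mult_right_zero) simp
qed

lemma integral_times_trig_sum:
  assumes "integrable circle_measure f"
  shows "(\<integral>t. f t * (\<Sum>n\<in>A. c n * cis (of_int n * t)) \<partial>circle_measure)
      = 2 * pi * (\<Sum>n\<in>A. c n * fourier_coeff f (- n))"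
proof -
  have "(\<integral>t. f t * (\<Sum>n\<in>A. c n * cis (of_int n * t)) \<partial>circle_measure)
      = (\<integral>t. (\<Sum>n\<in>A. c n * (f t * cis (of_int n * t))) \<partial>circle_measure)"
    by (simp add: sum_distrib_left mult_ac)
  also have "\<dots> = (\<Sum>n\<in>A. c n * (2 * pi * fourier_coeff f (- n)))"
    using assms by (subst Bochner_Integration.integral_sum) (auto simp: integrable_circle_times_cis fourier_coeff_eq)
  finally show ?thesis by (simp add: sum_distrib_left mult_ac)
qed

text \<open>For \<alpha> in the unit disc every factor is nonnegative, so the product is its own
  absolute value. Being real, it has conjugate coefficients at opposite frequencies, yet arbitrary
  complex \<alpha> are usable because the spectrum of \<open>h\<close> is one-sided.\<close>

definition riesz_product :: "(nat \<Rightarrow> complex) \<Rightarrow> (nat \<Rightarrow> nat) \<Rightarrow> nat \<Rightarrow> real \<Rightarrow> complex" where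
  "riesz_product \<alpha> q L t = of_real (\<Prod>k<L. 1 + Re (\<alpha> k * cis (real (q k) * t)))"

lemma riesz_product_continuous: "continuous_on S (riesz_product \<alpha> q L)"
  unfolding riesz_product_def by (intro continuous_intros)

lemma riesz_product_Suc:
  "riesz_product \<alpha> q (Suc L) t = riesz_product \<alpha> q L t
     + riesz_product \<alpha> q L t * (\<alpha> L / 2 * cis (of_int (int (q L)) * t))
     + riesz_product \<alpha> q L t * (cnj (\<alpha> L) / 2 * cis (of_int (- int (q L)) * t))"
proof -
  define z where "z = \<alpha> L * cis (real (q L) * t)"
  have "of_real (1 + Re z) = 1 + z / 2 + cnj z / 2" by (simp add: complex_eq_iff)
  moreover have "cnj z = cnj (\<alpha> L) * cis (- (real (q L) * t))" by (simp add: z_def cis_cnj)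
  ultimately have "of_real (1 + Re z) = 1 + \<alpha> L / 2 * cis (of_int (int (q L)) * t) + cnj (\<alpha> L) / 2 * cis (of_int (- int (q L)) * t)"
    by (simp add: z_def)
  moreover have "riesz_product \<alpha> q (Suc L) t = riesz_product \<alpha> q L t * of_real (1 + Re z)"
    by (simp add: riesz_product_def z_def)
  ultimately show ?thesis by (simp add: distrib_left)
qed

lemma fourier_coeff_riesz_product_Suc:
  "fourier_coeff (riesz_product \<alpha> q (Suc L)) n = fourier_coeff (riesz_product \<alpha> q L) n
     + \<alpha> L / 2 * fourier_coeff (riesz_product \<alpha> q L) (n - int (q L))
     + cnj (\<alpha> L) / 2 * fourier_coeff (riesz_product \<alpha> q L) (n + int (q L))"
proof -
  have i: "integrable circle_measure (riesz_product \<alpha> q L)"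
    by (rule integrable_circle_continuous[OF riesz_product_continuous])
  have c: "integrable circle_measure (\<lambda>t. riesz_product \<alpha> q L t * (c * cis (of_int m * t)))" for c m
    by (rule integrable_circle_times_continuous[OF i]) (intro continuous_intros)
  show ?thesis
    unfolding riesz_product_Suc[abs_def] fourier_coeff_times_cis
      fourier_coeff_add[OF Bochner_Integration.integrable_add[OF i c] c] fourier_coeff_add[OF i c]
    by simp
qed

locale lacunary_frequencies =
  fixes q :: "nat \<Rightarrow> nat"
  assumes pos: "q 0 > 0" and gap: "4 * q k \<le> q (Suc k)"
begin

lemma frequency_pos: "q k > 0"
  using pos gap by (induction k) (auto intro: less_le_trans[OF _ gap])

lemma index_le_frequency: "k \<le> q k"
proof (induction k)
  case (Suc k)
  then show ?case using gap[of k] frequency_pos[of k] by linarith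
qed simp

lemma gap_less: "k < L \<Longrightarrow> 4 * q k \<le> q L"
proof (induction L)
  case (Suc L)
  then show ?case using gap[of L] by (cases "k = L") (auto simp: less_Suc_eq)
qed simp

text \<open>The product of the first \<open>L\<close> factors has its spectrum in
  \<open>\<bar>n\<bar> < q L / 2\<close>. The next factor adds translates by \<open>q L\<close> and
  \<open>- q L\<close>, which are disjoint from it and, by the ratio 4, remain below
  \<open>2 * q L \<le> q (Suc L) / 2\<close>. Thus coefficients already present are never altered
  later, which gives the exact values at 0 and at the frequencies.\<close>

lemma fourier_coeff_riesz_product_far:
  "int (q L) \<le> 2 * \<bar>n\<bar> \<Longrightarrow> fourier_coeff (riesz_product \<alpha> q L) n = 0"
proof (induction L arbitrary: n)
  case 0
  then have "n \<noteq> 0" using pos by auto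
  then show ?case using fourier_coeff_cis[of 1 0 n] by (simp add: riesz_product_def[abs_def])
next
  case (Suc L)
  have "4 * int (q L) \<le> int (q (Suc L))" using gap[of L] by linarith
  then have "int (q L) \<le> 2 * \<bar>n\<bar>" "int (q L) \<le> 2 * \<bar>n - int (q L)\<bar>" "int (q L) \<le> 2 * \<bar>n + int (q L)\<bar>"
    using Suc.prems of_nat_0_le_iff[of "q L", where ?'a = int] by (auto simp: abs_if split: if_splits)
  then show ?case using Suc.IH by (simp add: fourier_coeff_riesz_product_Suc)
qed

lemma fourier_coeff_riesz_product_0: "fourier_coeff (riesz_product \<alpha> q L) 0 = 1"
proof (induction L)
  case 0
  show ?case using fourier_coeff_cis[of 1 0 0] by (simp add: riesz_product_def[abs_def])
next
  case (Suc L)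
  then show ?case by (simp add: fourier_coeff_riesz_product_Suc fourier_coeff_riesz_product_far)
qed

lemma fourier_coeff_riesz_product_frequency:
  "k < L \<Longrightarrow> fourier_coeff (riesz_product \<alpha> q L) (int (q k)) = \<alpha> k / 2"
proof (induction L)
  case (Suc L)
  show ?case
  proof (cases "k = L")
    case True
    then show ?thesis
      by (simp add: fourier_coeff_riesz_product_Suc fourier_coeff_riesz_product_far fourier_coeff_riesz_product_0)
  next
    case False
    then have "k < L" using Suc.prems by simp
    moreover have "4 * int (q k) \<le> int (q L)" using gap_less[OF \<open>k < L\<close>] by linarith
    ultimately show ?thesis
      using Suc.IH by (simp add: fourier_coeff_riesz_product_Suc fourier_coeff_riesz_product_far)
  qed
qed simp

text \<open>The multiplier is convolution with the Riesz product divided by \<open>2 * pi\<close>, a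
  probability density because the product is nonnegative with zeroth coefficient 1. Averages of
  translates do not increase the sup norm.\<close>

lemma riesz_multiplier_bound:
  assumes \<alpha>: "\<And>k. norm (\<alpha> k) \<le> 1" and A: "finite A"
    and bd: "\<And>t. norm (\<Sum>n\<in>A. c n * cis (of_int n * t)) \<le> 1"
  shows "norm (\<Sum>n\<in>A. c n * fourier_coeff (riesz_product \<alpha> q L) n * cis (of_int n * t)) \<le> 1"
proof -
  let ?R = "riesz_product \<alpha> q L"
  have i: "integrable circle_measure ?R"
    by (rule integrable_circle_continuous[OF riesz_product_continuous])
  have nR: "of_real (norm (?R u)) = ?R u" for u
  proof -
    have "1 + Re (\<alpha> k * cis (real (q k) * u)) \<ge> 0" for k
      using \<alpha>[of k] abs_Re_le_cmod[of "\<alpha> k * cis (real (q k) * u)"] by (simp add: norm_mult)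
    then have "(\<Prod>k<L. 1 + Re (\<alpha> k * cis (real (q k) * u))) \<ge> 0" by (intro prod_nonneg) auto
    then show ?thesis unfolding riesz_product_def norm_of_real by (simp only: abs_of_nonneg)
  qed
  \<comment> \<open>Integration against the frequency \<open>n\<close> picks out the coefficient at
    \<open>- n\<close>, hence the reflection of the index set.\<close>
  have "2 * pi * (\<Sum>n\<in>A. c n * fourier_coeff ?R n * cis (of_int n * t))
      = 2 * pi * (\<Sum>n\<in>uminus ` A. c (- n) * cis (of_int (- n) * t) * fourier_coeff ?R (- n))"
    by (subst sum.reindex) (auto simp: mult_ac)
  also have "\<dots> = (\<integral>u. ?R u * (\<Sum>n\<in>uminus ` A. c (- n) * cis (of_int (- n) * t) * cis (of_int n * u)) \<partial>circle_measure)"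
    by (rule integral_times_trig_sum[OF i, symmetric])
  also have "\<dots> = (\<integral>u. ?R u * (\<Sum>n\<in>A. c n * cis (of_int n * (t - u))) \<partial>circle_measure)"
    by (intro Bochner_Integration.integral_cong refl, subst sum.reindex)
       (auto simp: mult.assoc cis_mult right_diff_distrib)
  also have "norm \<dots> \<le> (\<integral>u. norm (?R u) \<partial>circle_measure)"
  proof (rule Bochner_Integration.integral_norm_bound_integral)
    show "integrable circle_measure (\<lambda>u. ?R u * (\<Sum>n\<in>A. c n * cis (of_int n * (t - u))))"
      by (rule integrable_circle_times_continuous[OF i]) (intro continuous_intros)
    show "norm (?R u * (\<Sum>n\<in>A. c n * cis (of_int n * (t - u)))) \<le> norm (?R u)" for u
      using bd[of "t - u"] by (simp add: norm_mult mult_right_le_one_le)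
  qed (use i in auto)
  also have "\<dots> = 2 * pi"
  proof -
    have "complex_of_real (\<integral>u. norm (?R u) \<partial>circle_measure) = (\<integral>u. of_real (norm (?R u)) \<partial>circle_measure)"
      by simp
    also have "\<dots> = (\<integral>u. ?R u * cis (of_int 0 * u) \<partial>circle_measure)" unfolding nR by simp
    also have "\<dots> = of_real (2 * pi)" unfolding fourier_coeff_eq by (simp add: fourier_coeff_riesz_product_0)
    finally show ?thesis by (simp only: of_real_eq_iff)
  qed
  finally show ?thesis by (simp add: norm_mult)
qed

text \<open>By transposition, the multiplier taking \<open>h\<close> to \<open>v\<close> is moved
  onto the test polynomial, where it is a Riesz multiplier and preserves the sup bound. The Riesz
  coefficients are only \<open>\<alpha> k / 2\<close>, which costs the factor 2. Off the spectrum
  the multiplier may take any values, since \<open>h\<close> and \<open>v\<close> have no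
  coefficients there.\<close>

lemma L1_norm_multiplier_le:
  assumes h: "integrable circle_measure h" "\<And>n. n \<notin> range (\<lambda>k. - int (q k)) \<Longrightarrow> fourier_coeff h n = 0"
    and v: "integrable circle_measure v" "\<And>n. n \<notin> range (\<lambda>k. - int (q k)) \<Longrightarrow> fourier_coeff v n = 0"
    and vh: "\<And>k. fourier_coeff v (- int (q k)) = \<theta> k * fourier_coeff h (- int (q k))"
    and \<theta>: "\<And>k. norm (\<theta> k) \<le> \<epsilon>" and \<epsilon>: "\<epsilon> > 0"
  shows "(\<integral>t. norm (v t) \<partial>circle_measure) \<le> 2 * \<epsilon> * (\<integral>t. norm (h t) \<partial>circle_measure)"
proof (rule L1_norm_le_trig_poly_test[OF v(1)])
  fix \<phi> assume "trig_poly \<phi>" and \<phi>1: "\<And>t. norm (\<phi> t) \<le> 1"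
  then obtain A c where A: "finite A" and \<phi>: "\<phi> = (\<lambda>t. \<Sum>n\<in>A. c n * cis (of_int n * t))"
    using trig_poly_expansion by blast
  define \<alpha> where "\<alpha> k = \<theta> k / of_real \<epsilon>" for k
  have \<alpha>: "norm (\<alpha> k) \<le> 1" for k using \<theta>[of k] \<epsilon> by (simp add: \<alpha>_def norm_divide)
  \<comment> \<open>Since \<open>k \<le> q k\<close>, this many factors reach every \<open>k\<close>
    for which \<open>q k\<close> is a frequency of the test polynomial.\<close>
  define L where "L = Suc (nat (\<Sum>n\<in>A. \<bar>n\<bar>))"
  define r where "r = fourier_coeff (riesz_product \<alpha> q L)"
  have coeff: "fourier_coeff v (- n) = 2 * \<epsilon> * r n * fourier_coeff h (- n)" if "n \<in> A" for n
  proof (cases "n \<in> range (\<lambda>k. int (q k))")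
    case True
    then obtain k where k: "n = int (q k)" by blast
    have "\<bar>n\<bar> \<le> (\<Sum>n\<in>A. \<bar>n\<bar>)" using A that by (intro member_le_sum) auto
    then have "k < L" using index_le_frequency[of k] k by (simp add: L_def)
    then have "r n = \<alpha> k / 2" unfolding r_def k by (rule fourier_coeff_riesz_product_frequency)
    then show ?thesis using vh[of k] \<epsilon> by (simp add: k \<alpha>_def)
  next
    case False
    then have "- n \<notin> range (\<lambda>k. - int (q k))" by auto
    then show ?thesis using h(2) v(2) by simp
  qed
  have "(\<integral>t. v t * \<phi> t \<partial>circle_measure) = 2 * pi * (\<Sum>n\<in>A. c n * fourier_coeff v (- n))"
    unfolding \<phi> by (rule integral_times_trig_sum[OF v(1)])
  also have "\<dots> = 2 * pi * (\<Sum>n\<in>A. (2 * \<epsilon> * (c n * r n)) * fourier_coeff h (- n))"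
    using coeff by (intro arg_cong[where f = "\<lambda>x. _ * x"] sum.cong refl) (simp add: mult_ac)
  also have "\<dots> = (\<integral>t. h t * (\<Sum>n\<in>A. (2 * \<epsilon> * (c n * r n)) * cis (of_int n * t)) \<partial>circle_measure)"
    by (rule integral_times_trig_sum[OF h(1), symmetric])
  also have "norm \<dots> \<le> (\<integral>t. 2 * \<epsilon> * norm (h t) \<partial>circle_measure)"
  proof (rule Bochner_Integration.integral_norm_bound_integral)
    show "integrable circle_measure (\<lambda>t. h t * (\<Sum>n\<in>A. (2 * \<epsilon> * (c n * r n)) * cis (of_int n * t)))"
      by (rule integrable_circle_times_continuous[OF h(1)]) (intro continuous_intros)
    show "norm (h t * (\<Sum>n\<in>A. (2 * \<epsilon> * (c n * r n)) * cis (of_int n * t))) \<le> 2 * \<epsilon> * norm (h t)" for t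
    proof -
      have "norm (\<Sum>n\<in>A. c n * r n * cis (of_int n * t)) \<le> 1"
        unfolding r_def using \<phi>1 by (intro riesz_multiplier_bound \<alpha> A) (simp add: \<phi>)
      moreover have "(\<Sum>n\<in>A. (2 * \<epsilon> * (c n * r n)) * cis (of_int n * t)) = 2 * \<epsilon> * (\<Sum>n\<in>A. c n * r n * cis (of_int n * t))"
        by (simp add: sum_distrib_left mult.assoc)
      ultimately show ?thesis
        using \<epsilon> by (simp add: norm_mult mult_right_le_one_le mult.left_commute)
    qed
  qed (use h in auto)
  finally show "norm (\<integral>t. v t * \<phi> t \<partial>circle_measure) \<le> 2 * \<epsilon> * (\<integral>t. norm (h t) \<partial>circle_measure)"
    by simp
qed

end

section \<open>Differences of functions with lacunary spectrum\<close>

text \<open>On half-open periods a shift can be cut into disjoint pieces and reassembled without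
  treating endpoints.\<close>

lemma integrable_circle_iff: "integrable circle_measure u \<longleftrightarrow> set_integrable lebesgue {0<..2*pi} u"
  for u :: "real \<Rightarrow> complex"
proof -
  have "integrable circle_measure u \<longleftrightarrow> u absolutely_integrable_on {0..2*pi}"
    unfolding circle_measure_def set_integrable_def by (subst integrable_restrict_space) auto
  also have "\<dots> \<longleftrightarrow> u absolutely_integrable_on {0<..2*pi}"
  proof (rule absolutely_integrable_spike_set_eq)
    show "negligible {x \<in> {0..2*pi} - {0<..2*pi}. u x \<noteq> 0}"
      by (rule negligible_subset[of "{0}"]) auto
    show "negligible {x \<in> {0<..2*pi} - {0..2*pi}. u x \<noteq> 0}"
      by (rule negligible_subset[of "{0}"]) auto
  qed
  finally show ?thesis .
qed

lemma integral_circle_eq: 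
  fixes u :: "real \<Rightarrow> complex"
  assumes "integrable circle_measure u"
  shows "integral\<^sup>L circle_measure u = (LINT t:{0<..2*pi}|lebesgue. u t)"
proof -
  have "integral\<^sup>L circle_measure u = integral {0..2*pi} u"
    using assms unfolding circle_measure_def by (intro lebesgue_integral_eq_integral) auto
  also have "\<dots> = integral {0<..2*pi} u"
    by (rule integral_spike_set; rule negligible_subset[of "{0}"]) auto
  also have "\<dots> = (LINT t:{0<..2*pi}|lebesgue. u t)"
    using assms unfolding integrable_circle_iff by (rule set_lebesgue_integral_eq_integral(2)[symmetric])
  finally show ?thesis .
qed

lemma measure_circle_measure: "measure circle_measure {0..2*pi} = 2 * pi"
  by (simp add: circle_measure_def measure_restrict_space)

lemma set_lebesgue_shift:
  fixes u :: "real \<Rightarrow> complex"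
  shows "set_integrable lebesgue {a<..b} (\<lambda>t. u (t + c)) \<longleftrightarrow> set_integrable lebesgue {a+c<..b+c} u"
    and "(LINT t:{a<..b}|lebesgue. u (t + c)) = (LINT t:{a+c<..b+c}|lebesgue. u t)"
proof -
  have eq: "indicat_real {a<..b} x *\<^sub>R u (x + c) = indicat_real {a+c<..b+c} (c + 1 * x) *\<^sub>R u (c + 1 * x)" for x
    by (auto simp: indicator_def add.commute)
  show "set_integrable lebesgue {a<..b} (\<lambda>t. u (t + c)) \<longleftrightarrow> set_integrable lebesgue {a+c<..b+c} u"
    unfolding set_integrable_def eq
    using lebesgue_integrable_real_affine_iff[of 1 "\<lambda>x. indicat_real {a+c<..b+c} x *\<^sub>R u x" c] by simp
  show "(LINT t:{a<..b}|lebesgue. u (t + c)) = (LINT t:{a+c<..b+c}|lebesgue. u t)"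
    unfolding set_lebesgue_integral_def eq
    using lebesgue_integral_real_affine[of 1 "\<lambda>x. indicat_real {a+c<..b+c} x *\<^sub>R u x" c] by simp
qed

lemma circle_shift:
  fixes u :: "real \<Rightarrow> complex"
  assumes per: "\<And>t. u (t + 2 * pi) = u t" and u: "integrable circle_measure u" and s: "0 \<le> s" "s \<le> 2 * pi"
  shows "integrable circle_measure (\<lambda>t. u (t + s))"
    and "(\<integral>t. u (t + s) \<partial>circle_measure) = (\<integral>t. u t \<partial>circle_measure)"
proof -
  have i: "set_integrable lebesgue {0<..2*pi} u" using u by (simp add: integrable_circle_iff)
  have i1: "set_integrable lebesgue {0<..s} u" and i2: "set_integrable lebesgue {s<..2*pi} u"
    using s by (auto intro!: set_integrable_subset[OF i])
  have i3: "set_integrable lebesgue {2*pi<..2*pi+s} u"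
    using i1 set_lebesgue_shift(1)[of 0 s u "2*pi"] by (simp add: per add.commute)
  have split: "{s<..2*pi} \<union> {2*pi<..2*pi+s} = {0+s<..2*pi+s}" using s by auto
  have split0: "{0<..s} \<union> {s<..2*pi} = {0<..2*pi}" using s by auto
  have "set_integrable lebesgue ({s<..2*pi} \<union> {2*pi<..2*pi+s}) u"
    by (rule set_integrable_Un[OF i2 i3]) auto
  then have "set_integrable lebesgue {0<..2*pi} (\<lambda>t. u (t + s))"
    unfolding set_lebesgue_shift(1) split .
  then show int: "integrable circle_measure (\<lambda>t. u (t + s))"
    by (simp add: integrable_circle_iff)
  have "(\<integral>t. u (t + s) \<partial>circle_measure) = (LINT t:{s<..2*pi} \<union> {2*pi<..2*pi+s}|lebesgue. u t)"
    unfolding integral_circle_eq[OF int] set_lebesgue_shift(2) split ..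
  also have "\<dots> = (LINT t:{s<..2*pi}|lebesgue. u t) + (LINT t:{0+2*pi<..s+2*pi}|lebesgue. u t)"
    by (subst set_integral_Un[OF _ i2 i3]) (auto simp: add.commute)
  also have "\<dots> = (LINT t:{0<..s}|lebesgue. u t) + (LINT t:{s<..2*pi}|lebesgue. u t)"
    unfolding set_lebesgue_shift(2)[symmetric] per by (simp add: add.commute)
  also have "\<dots> = (LINT t:{0<..s} \<union> {s<..2*pi}|lebesgue. u t)"
    by (subst set_integral_Un[OF _ i1 i2]) auto
  also have "\<dots> = (\<integral>t. u t \<partial>circle_measure)"
    unfolding split0 by (rule integral_circle_eq[OF u, symmetric])
  finally show "(\<integral>t. u (t + s) \<partial>circle_measure) = (\<integral>t. u t \<partial>circle_measure)" .
qed

text \<open>A member of \<open>L_spec\<close> has arbitrary values outside \<open>{0..2*pi}\<close>,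
  so it can be shifted only after extension. The value at \<open>2 * pi\<close> is replaced by the
  one at 0, a change on a null set.\<close>

definition periodic_extension :: "(real \<Rightarrow> 'a) \<Rightarrow> real \<Rightarrow> 'a" where
  "periodic_extension h t = h (t - 2 * pi * of_int \<lfloor>t / (2 * pi)\<rfloor>)"

lemma periodic_extension_periodic: "periodic_extension h (t + 2 * pi) = periodic_extension h t"
proof -
  have "(t + 2 * pi) / (2 * pi) = t / (2 * pi) + 1" by (simp add: field_simps)
  then show ?thesis unfolding periodic_extension_def by (simp add: algebra_simps)
qed

lemma periodic_extension_eq: "0 \<le> t \<Longrightarrow> t < 2 * pi \<Longrightarrow> periodic_extension h t = h t"
proof -
  assume "0 \<le> t" "t < 2 * pi"
  then have "\<lfloor>t / (2 * pi)\<rfloor> = 0" by (simp add: floor_eq_iff)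
  then show ?thesis by (simp add: periodic_extension_def)
qed

lemma AE_circle_neq: "AE t in circle_measure. t \<noteq> a"
proof -
  have "AE t in lebesgue. t \<notin> {a}" by (intro AE_not_in) auto
  then show ?thesis unfolding circle_measure_def by (subst AE_restrict_space_iff) auto
qed

lemma AE_periodic_extension_eq: "AE t in circle_measure. periodic_extension h t = h t"
  using AE_circle_neq[of "2*pi"]
  by (rule AE_mp[OF _ AE_I2]) (auto intro!: periodic_extension_eq)

lemma periodic_extension_measurable:
  fixes h :: "real \<Rightarrow> complex"
  assumes h: "h \<in> borel_measurable circle_measure"
  shows "periodic_extension h \<in> borel_measurable circle_measure"
proof -
  have "(\<lambda>t. if t = 2 * pi then h 0 else h t) \<in> borel_measurable circle_measure"
  proof (intro measurable_If)
    have "{t \<in> space circle_measure. t = 2 * pi} = {2 * pi}" by auto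
    then show "{t \<in> space circle_measure. t = 2 * pi} \<in> sets circle_measure"
      unfolding circle_measure_def by (simp add: sets_restrict_space_iff)
  qed (use h in auto)
  moreover have "(if t = 2 * pi then h 0 else h t) = periodic_extension h t" if "t \<in> space circle_measure" for t
    using that periodic_extension_eq[of t h] periodic_extension_periodic[of h 0] periodic_extension_eq[of 0 h] by auto
  ultimately show ?thesis by (rule measurable_cong[THEN iffD1, rotated])
qed

lemma integrable_periodic_extension:
  fixes h :: "real \<Rightarrow> complex"
  assumes h: "integrable circle_measure h"
  shows "integrable circle_measure (periodic_extension h)"
    and "fourier_coeff (periodic_extension h) n = fourier_coeff h n"
proof -
  have m: "periodic_extension h \<in> borel_measurable circle_measure"
    using h by (intro periodic_extension_measurable borel_measurable_integrable)
  show i: "integrable circle_measure (periodic_extension h)"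
    using integrable_cong_AE[of "periodic_extension h" circle_measure h] h m AE_periodic_extension_eq[of h] by auto
  have "(\<integral>t. periodic_extension h t * cis (of_int (- n) * t) \<partial>circle_measure)
      = (\<integral>t. h t * cis (of_int (- n) * t) \<partial>circle_measure)"
    using AE_periodic_extension_eq[of h]
    by (intro integral_cong_AE borel_measurable_integrable integrable_circle_times_cis i h) auto
  then show "fourier_coeff (periodic_extension h) n = fourier_coeff h n"
    unfolding fourier_coeff_def exp_frequency_eq_cis by simp
qed

lemma fourier_coeff_shift:
  fixes u :: "real \<Rightarrow> complex"
  assumes per: "\<And>t. u (t + 2 * pi) = u t" and u: "integrable circle_measure u" and s: "0 \<le> s" "s \<le> 2 * pi"
  shows "fourier_coeff (\<lambda>t. u (t + s)) n = cis (of_int n * s) * fourier_coeff u n"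
proof -
  define w where "w t = u t * cis (of_int (- n) * t)" for t
  have "cis (of_int (- n) * (t + 2 * pi)) = cis (of_int (- n) * t)" for t
  proof -
    have "cis (of_int (- n) * (t + 2 * pi)) = cis (of_int (- n) * t) * cis (2 * pi * of_int (- n))"
      unfolding cis_mult by (simp only: distrib_left mult_ac)
    also have "cis (2 * pi * of_int (- n)) = 1" by (rule cis_multiple_2pi) simp
    finally show ?thesis by simp
  qed
  then have perw: "w (t + 2 * pi) = w t" for t by (simp add: w_def per)
  have "(\<integral>t. u (t + s) * cis (of_int (- n) * t) \<partial>circle_measure)
      = (\<integral>t. cis (of_int n * s) * w (t + s) \<partial>circle_measure)"
  proof (intro Bochner_Integration.integral_cong refl)
    fix t
    have "cis (of_int (- n) * t) = cis (of_int n * s) * cis (of_int (- n) * (t + s))"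
      by (simp add: cis_mult distrib_left)
    then show "u (t + s) * cis (of_int (- n) * t) = cis (of_int n * s) * w (t + s)"
      by (simp add: w_def mult_ac)
  qed
  also have "\<dots> = cis (of_int n * s) * (\<integral>t. w t \<partial>circle_measure)"
    using circle_shift(2)[of w s] perw s integrable_circle_times_cis[OF u, of "of_int (- n)"]
    by (simp add: w_def[abs_def])
  finally show ?thesis unfolding fourier_coeff_def exp_frequency_eq_cis by (simp add: w_def[abs_def])
qed

text \<open>The finitely many frequencies below the index from which the sequence is lacunary are removed before
  the Riesz product estimate applies.\<close>

lemma L_spec_difference_small:
  fixes q :: "nat \<Rightarrow> nat"
  assumes mono: "strict_mono_on {1..} q" and pos: "\<And>k. k \<ge> 1 \<Longrightarrow> q k > 0"
    and lim: "filterlim (\<lambda>k. real (q (Suc k)) / real (q k)) at_top sequentially"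
    and h: "h \<in> L_spec {- int (q k) | k. k \<ge> 1}"
  obtains C where "\<And>\<epsilon> s. 0 < \<epsilon> \<Longrightarrow> 0 \<le> s \<Longrightarrow> s \<le> 2 * pi \<Longrightarrow> (\<And>k. k \<ge> 1 \<Longrightarrow> norm (cis (real (q k) * s) - 1) \<le> \<epsilon>)
     \<Longrightarrow> integrable circle_measure (\<lambda>t. periodic_extension h (t + s) - periodic_extension h t)
        \<and> (\<integral>t. norm (periodic_extension h (t + s) - periodic_extension h t) \<partial>circle_measure) \<le> C * \<epsilon>"
proof -
  let ?H = "periodic_extension h"
  have h0: "integrable circle_measure h" "\<And>n. n \<notin> {- int (q k) | k. k \<ge> 1} \<Longrightarrow> fourier_coeff h n = 0"
    using h by (auto simp: L_spec_def)
  have inj: "q j = q k \<longleftrightarrow> j = k" if "j \<ge> 1" "k \<ge> 1" for j k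
    using strict_mono_on_imp_inj_on[OF mono] that by (auto simp: inj_on_def)
  have "\<forall>\<^sub>F k in sequentially. 4 \<le> real (q (Suc k)) / real (q k)"
    using lim unfolding filterlim_at_top by blast
  then obtain K0 where K0: "\<And>k. k \<ge> K0 \<Longrightarrow> 4 \<le> real (q (Suc k)) / real (q k)"
    unfolding eventually_sequentially by blast
  define K where "K = max 1 K0"
  have gapK: "4 * q k \<le> q (Suc k)" if "k \<ge> K" for k
  proof -
    have "4 * real (q k) \<le> real (q (Suc k))"
      using K0[of k] pos[of k] that by (simp add: K_def field_simps)
    then show ?thesis by linarith
  qed
  define q' where "q' k = q (K + k)" for k
  interpret lacunary_frequencies q'
  proof
    show "q' 0 > 0" using pos[of K] by (simp add: q'_def K_def)
    show "4 * q' k \<le> q' (Suc k)" for k using gapK[of "K + k"] by (simp add: q'_def)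
  qed
  \<comment> \<open>\<open>p\<close> is the part of \<open>h\<close> at the frequencies preceding
    the lacunary range. Its difference is estimated term by term, which gives the second summand of
    \<open>C\<close>; neither summand involves \<open>s\<close> or \<epsilon>.\<close>
  define p where "p t = (\<Sum>k\<in>{1..<K}. fourier_coeff h (- int (q k)) * cis (of_int (- int (q k)) * t))" for t
  define C where "C = 2 * (\<integral>t. norm (?H t - p t) \<partial>circle_measure)
     + (\<Sum>k\<in>{1..<K}. norm (fourier_coeff h (- int (q k)))) * (2 * pi)"
  have H: "integrable circle_measure ?H" "fourier_coeff ?H n = fourier_coeff h n" for n
    using integrable_periodic_extension[OF h0(1)] by auto
  have pint: "integrable circle_measure p"
    unfolding p_def by (intro Bochner_Integration.integrable_sum integrable_circle_cis)
  \<comment> \<open>A frequency outside the tail either is absent from \<open>h\<close> or was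
    removed with \<open>p\<close>; in both cases the corrected functions have no coefficient
    there.\<close>
  have off: "fourier_coeff h n = 0 \<and> (\<forall>k\<in>{1..<K}. - int (q k) \<noteq> n) \<or> (\<exists>k\<in>{1..<K}. n = - int (q k))"
    if "n \<notin> range (\<lambda>k. - int (q' k))" for n
  proof (cases "n \<in> {- int (q k) | k. k \<ge> 1}")
    case True
    then obtain k where k: "k \<ge> 1" "n = - int (q k)" by blast
    have "k < K"
    proof (rule ccontr)
      assume "\<not> k < K"
      then have "n = - int (q' (k - K))" using k by (simp add: q'_def)
      then show False using that by blast
    qed
    then show ?thesis using k by auto
  qed (use h0(2) in auto)
  have single: "(\<Sum>k\<in>{1..<K}. if - int (q k) = - int (q j) then f k else 0) = (if j < K then f j else 0)"
    if "j \<ge> 1" for j and f :: "nat \<Rightarrow> complex"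
  proof -
    have "(\<Sum>k\<in>{1..<K}. if - int (q k) = - int (q j) then f k else 0) = (\<Sum>k\<in>{1..<K}. if j = k then f k else 0)"
      using that inj by (intro sum.cong refl) auto
    then show ?thesis using that by simp
  qed
  have "integrable circle_measure (\<lambda>t. ?H (t + s) - ?H t) \<and>
     (\<integral>t. norm (?H (t + s) - ?H t) \<partial>circle_measure) \<le> C * \<epsilon>"
    if \<epsilon>: "0 < \<epsilon>" and s: "0 \<le> s" "s \<le> 2 * pi" and small: "\<And>k. k \<ge> 1 \<Longrightarrow> norm (cis (real (q k) * s) - 1) \<le> \<epsilon>" for \<epsilon> s
  proof -
    define \<theta> where "\<theta> k = cis (of_int (- int (q k)) * s) - 1" for k
    have \<theta>: "norm (\<theta> k) \<le> \<epsilon>" if "k \<ge> 1" for k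
    proof -
      have "\<theta> k = cnj (cis (real (q k) * s) - 1)" by (simp add: \<theta>_def cis_cnj)
      then show ?thesis using small[OF that] by (simp only: complex_mod_cnj)
    qed
    define p' where "p' t = (\<Sum>k\<in>{1..<K}. \<theta> k * fourier_coeff h (- int (q k)) * cis (of_int (- int (q k)) * t))" for t
    have p'int: "integrable circle_measure p'"
      unfolding p'_def by (intro Bochner_Integration.integrable_sum integrable_circle_cis)
    define v where "v t = ?H (t + s) - ?H t" for t
    note shift = circle_shift(1)[OF periodic_extension_periodic H(1) s]
    have vint: "integrable circle_measure v"
      unfolding v_def by (intro Bochner_Integration.integrable_diff shift H)
    have vcoeff: "fourier_coeff v n = (cis (of_int n * s) - 1) * fourier_coeff h n" for n
      unfolding v_def fourier_coeff_diff[OF shift H(1)] fourier_coeff_shift[OF periodic_extension_periodic H(1) s] H(2)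
      by (simp add: algebra_simps)
    have pcoeff: "fourier_coeff p n = (\<Sum>k\<in>{1..<K}. if - int (q k) = n then fourier_coeff h (- int (q k)) else 0)" for n
      unfolding p_def by (subst fourier_coeff_sum) (simp_all only: integrable_circle_cis fourier_coeff_cis)
    have p'coeff: "fourier_coeff p' n = (\<Sum>k\<in>{1..<K}. if - int (q k) = n then \<theta> k * fourier_coeff h (- int (q k)) else 0)" for n
      unfolding p'_def by (subst fourier_coeff_sum) (simp_all only: integrable_circle_cis fourier_coeff_cis)
    have d1: "fourier_coeff (\<lambda>t. ?H t - p t) n = fourier_coeff h n - fourier_coeff p n" for n
      using fourier_coeff_diff[OF H(1) pint] H(2) by simp
    have d2: "fourier_coeff (\<lambda>t. v t - p' t) n = fourier_coeff v n - fourier_coeff p' n" for n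
      using fourier_coeff_diff[OF vint p'int] by simp
    \<comment> \<open>A shift by \<open>s\<close> multiplies the coefficient at \<open>n\<close> by
      \<open>cis (n * s)\<close>, so the difference acts on the remaining spectrum as the multiplier
      \<theta>.\<close>
    have "(\<integral>t. norm (v t - p' t) \<partial>circle_measure) \<le> 2 * \<epsilon> * (\<integral>t. norm (?H t - p t) \<partial>circle_measure)"
    proof (rule L1_norm_multiplier_le[where \<theta> = "\<lambda>k. \<theta> (K + k)"])
      show "fourier_coeff (\<lambda>t. ?H t - p t) n = 0" if "n \<notin> range (\<lambda>k. - int (q' k))" for n
        using off[OF that]
      proof (elim disjE conjE bexE)
        assume "fourier_coeff h n = 0" "\<forall>k\<in>{1..<K}. - int (q k) \<noteq> n"
        then show ?thesis unfolding d1 pcoeff by (simp add: sum.neutral)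
      next
        fix j assume "j \<in> {1..<K}" "n = - int (q j)"
        then show ?thesis unfolding d1 pcoeff using single[of j "\<lambda>k. fourier_coeff h (- int (q k))"] by simp
      qed
      show "fourier_coeff (\<lambda>t. v t - p' t) n = 0" if "n \<notin> range (\<lambda>k. - int (q' k))" for n
        using off[OF that]
      proof (elim disjE conjE bexE)
        assume "fourier_coeff h n = 0" "\<forall>k\<in>{1..<K}. - int (q k) \<noteq> n"
        then show ?thesis unfolding d2 p'coeff vcoeff by (simp add: sum.neutral)
      next
        fix j assume "j \<in> {1..<K}" "n = - int (q j)"
        then show ?thesis unfolding d2 p'coeff vcoeff
          using single[of j "\<lambda>k. \<theta> k * fourier_coeff h (- int (q k))"] by (simp add: \<theta>_def)
      qed
      show "fourier_coeff (\<lambda>t. v t - p' t) (- int (q' k)) = \<theta> (K + k) * fourier_coeff (\<lambda>t. ?H t - p t) (- int (q' k))" for k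
      proof -
        have "K + k \<ge> 1" by (simp add: K_def)
        then show ?thesis
          unfolding d1 d2 pcoeff p'coeff vcoeff q'_def
          using single[of "K + k" "\<lambda>k. fourier_coeff h (- int (q k))"]
            single[of "K + k" "\<lambda>k. \<theta> k * fourier_coeff h (- int (q k))"] by (simp add: \<theta>_def)
      qed
      show "norm (\<theta> (K + k)) \<le> \<epsilon>" for k by (rule \<theta>) (simp add: K_def)
    qed (use \<epsilon> H pint vint p'int in auto)
    moreover have "(\<integral>t. norm (p' t) \<partial>circle_measure) \<le> (\<integral>t. \<epsilon> * (\<Sum>k\<in>{1..<K}. norm (fourier_coeff h (- int (q k)))) \<partial>circle_measure)"
    proof (rule integral_mono)
      show "integrable circle_measure (\<lambda>t. \<epsilon> * (\<Sum>k\<in>{1..<K}. norm (fourier_coeff h (- int (q k)))))"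
        using finite_measure.integrable_const[OF finite_measure_circle_measure] by blast
      show "norm (p' t) \<le> \<epsilon> * (\<Sum>k\<in>{1..<K}. norm (fourier_coeff h (- int (q k))))" for t
        unfolding p'_def sum_distrib_left using \<theta>
        by (intro sum_norm_le) (auto simp: norm_mult intro!: mult_right_mono)
    qed (use p'int in auto)
    moreover have "(\<integral>t. \<epsilon> * (\<Sum>k\<in>{1..<K}. norm (fourier_coeff h (- int (q k)))) \<partial>circle_measure)
        = \<epsilon> * (\<Sum>k\<in>{1..<K}. norm (fourier_coeff h (- int (q k)))) * (2 * pi)"
      by (simp add: measure_circle_measure)
    moreover have "(\<integral>t. norm (v t) \<partial>circle_measure) \<le> (\<integral>t. norm (v t - p' t) + norm (p' t) \<partial>circle_measure)"
    proof (rule integral_mono)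
      show "norm (v t) \<le> norm (v t - p' t) + norm (p' t)" for t
        using norm_triangle_ineq[of "v t - p' t" "p' t"] by simp
    qed (use vint p'int in auto)
    moreover have "(\<integral>t. norm (v t - p' t) + norm (p' t) \<partial>circle_measure)
       = (\<integral>t. norm (v t - p' t) \<partial>circle_measure) + (\<integral>t. norm (p' t) \<partial>circle_measure)"
      using vint p'int by (intro Bochner_Integration.integral_add) auto
    ultimately have "(\<integral>t. norm (v t) \<partial>circle_measure) \<le> C * \<epsilon>"
      unfolding C_def distrib_right by (simp only: mult_ac)
    then show ?thesis using vint by (simp add: v_def[abs_def])
  qed
  then show ?thesis using that by blast
qed

section \<open>Diophantine approximation and the choice of the shift\<close>

lemma norm_cis_minus_one_le: "norm (cis x - 1) \<le> \<bar>x - 2 * pi * of_int m\<bar>"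
proof -
  have c: "cis x = cis (x - 2 * pi * of_int m)"
  proof -
    have "cis x = cis (x - 2 * pi * of_int m) * cis (2 * pi * of_int m)"
      by (subst cis_mult) simp
    also have "cis (2 * pi * of_int m) = 1" by (rule cis_multiple_2pi) simp
    finally show ?thesis by simp
  qed
  show ?thesis
    unfolding c using norm_cis_diff_le[of "x - 2 * pi * of_int m" 0] by simp
qed

text \<open>Every ratio is at least \<open>R\<close> from index \<open>K\<close> on, so rounding up to the next multiple of \<open>1 / q k\<close>
  successively for \<open>k = K, K + 1, \<dots>\<close> moves the point by amounts that decay geometrically.\<close>

lemma simultaneous_approximation:
  fixes q :: "nat \<Rightarrow> nat"
  assumes pos: "q K > 0" and R: "R \<ge> 2" and ratio: "\<And>k. k \<ge> K \<Longrightarrow> R * real (q k) \<le> real (q (Suc k))"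
  obtains x where "1 / real (q K) \<le> x"
    "\<And>k. k \<ge> K \<Longrightarrow> \<exists>m::int. \<bar>real (q k) * x - of_int m\<bar> \<le> 2 / R"
    "real (q K) * x - 1 \<le> 2 / R"
proof -
  have qpos: "q (K + k) > 0" for k
  proof (induction k)
    case (Suc k)
    have "0 < R * real (q (K + k))" using Suc R by simp
    also have "\<dots> \<le> real (q (K + Suc k))" using ratio[of "K + k"] by simp
    finally show ?case by simp
  qed (use pos in auto)
  \<comment> \<open>The numerators start at 1, so the limit point lies just above
    \<open>1 / q K\<close>; this later makes half of \<open>q K\<close> a frequency that the shift
    moves by almost half a turn.\<close>
  define m :: "nat \<Rightarrow> int" where
    "m = rec_nat 1 (\<lambda>k a. \<lceil>of_int a / real (q (K + k)) * real (q (K + Suc k))\<rceil>)"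
  have m0: "m 0 = 1" and mSuc: "m (Suc k) = \<lceil>of_int (m k) / real (q (K + k)) * real (q (K + Suc k))\<rceil>" for k
    by (simp_all add: m_def)
  define y where "y k = of_int (m k) / real (q (K + k))" for k
  have step: "y k \<le> y (Suc k)" "y (Suc k) \<le> y k + 1 / real (q (K + Suc k))" for k
  proof -
    have eq: "of_int (m (Suc k)) = y (Suc k) * real (q (K + Suc k))"
      using qpos[of "Suc k"] by (simp add: y_def)
    have "y k * real (q (K + Suc k)) \<le> y (Suc k) * real (q (K + Suc k))"
      unfolding eq[symmetric] mSuc by (simp add: y_def)
    then show "y k \<le> y (Suc k)" using qpos[of "Suc k"] by simp
    have "y (Suc k) * real (q (K + Suc k)) \<le> y k * real (q (K + Suc k)) + 1"
      unfolding eq[symmetric] mSuc by (simp add: y_def)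
    then show "y (Suc k) \<le> y k + 1 / real (q (K + Suc k))"
      using qpos[of "Suc k"] by (simp add: field_simps)
  qed
  text \<open>The majorant \<open>2 / q (K + k + 1)\<close> of the remaining displacement turns the bounds into a decreasing sequence.\<close>
  have up: "y (k + j) \<le> y k + 2 / real (q (K + Suc k)) - 2 / real (q (K + Suc (k + j)))" for k j
  proof (induction j)
    case (Suc j)
    define a b where "a = real (q (K + Suc (k + j)))" and "b = real (q (K + Suc (k + Suc j)))"
    have ab: "a > 0" "b > 0" using qpos[of "Suc (k + j)"] qpos[of "Suc (k + Suc j)"] by (auto simp: a_def b_def)
    have "2 * a \<le> R * a" using R ab by simp
    also have "\<dots> \<le> b" using ratio[of "K + Suc (k + j)"] by (simp add: a_def b_def)
    finally have "1 / a \<le> 2 / a - 2 / b" using ab by (simp add: field_simps)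
    moreover have "y (Suc (k + j)) \<le> y (k + j) + 1 / a" using step(2)[of "k + j"] by (simp add: a_def)
    ultimately show ?case using Suc.IH by (simp add: a_def b_def)
  qed simp
  have inc: "incseq y" using step(1) by (rule incseq_SucI)
  have up': "y j \<le> y k + 2 / real (q (K + Suc k))" if "k \<le> j" for k j
  proof -
    have "y j \<le> y k + 2 / real (q (K + Suc k)) - 2 / real (q (K + Suc j))"
      using up[of k "j - k"] that by simp
    moreover have "0 \<le> 2 / real (q (K + Suc j))" by simp
    ultimately show ?thesis by linarith
  qed
  have up0: "y j \<le> y 0 + 2 / real (q (K + Suc 0))" for j using up'[of 0 j] by simp
  obtain x where x: "y \<longlonglongrightarrow> x" "\<And>k. y k \<le> x"
    using incseq_convergent[OF inc, of "y 0 + 2 / real (q (K + Suc 0))"] up0 by blast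
  have x2: "x \<le> y k + 2 / real (q (K + Suc k))" for k
    by (rule LIMSEQ_le_const2[OF x(1)]) (use up' in blast)
  have close: "real (q (K + k)) * x - of_int (m k) \<le> 2 / R" "0 \<le> real (q (K + k)) * x - of_int (m k)" for k
  proof -
    define a b where "a = real (q (K + k))" and "b = real (q (K + Suc k))"
    have ab: "a > 0" "b > 0" using qpos[of k] qpos[of "Suc k"] by (auto simp: a_def b_def)
    have Rab: "R * a \<le> b" using ratio[of "K + k"] by (simp add: a_def b_def)
    have mk: "of_int (m k) = a * y k" using ab by (simp add: y_def a_def)
    have "a * x \<le> a * (y k + 2 / b)" using x2[of k] ab by (intro mult_left_mono) (auto simp: b_def)
    also have "\<dots> \<le> a * y k + 2 / R" using ab Rab R by (simp add: field_simps)
    finally show "real (q (K + k)) * x - of_int (m k) \<le> 2 / R" unfolding mk by (simp add: a_def)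
    show "0 \<le> real (q (K + k)) * x - of_int (m k)"
      using x(2)[of k] ab unfolding mk by (simp add: a_def)
  qed
  show ?thesis
  proof (rule that[of x])
    show "1 / real (q K) \<le> x" using x(2)[of 0] by (simp add: y_def m0)
    show "\<exists>m::int. \<bar>real (q k) * x - of_int m\<bar> \<le> 2 / R" if "k \<ge> K" for k
      using close[of "k - K"] that by (intro exI[of _ "m (k - K)"]) auto
    show "real (q K) * x - 1 \<le> 2 / R" using close(1)[of 0] by (simp add: m0)
  qed
qed

lemma norm_cis_minus_one_ge:
  assumes "pi / 3 \<le> x" "x \<le> 5 * pi / 3"
  shows "1 \<le> norm (cis x - 1)"
proof -
  have "cos x \<le> 1 / 2"
  proof (cases "x \<le> pi")
    case True
    then have "cos x \<le> cos (pi / 3)" using assms by (intro cos_monotone_0_pi_le) auto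
    then show ?thesis by (simp add: cos_60)
  next
    case False
    have "cos x = cos (2 * pi - x)" by (simp add: cos_diff)
    also have "\<dots> \<le> cos (pi / 3)" using False assms by (intro cos_monotone_0_pi_le) auto
    finally show ?thesis by (simp add: cos_60)
  qed
  have "(norm (cis x - 1))\<^sup>2 = (cos x - 1)\<^sup>2 + (sin x)\<^sup>2" by (simp add: cmod_power2)
  also have "\<dots> = 2 - 2 * cos x" using sin_cos_squared_add[of x] by (simp add: power2_eq_square algebra_simps)
  finally have "1\<^sup>2 \<le> (norm (cis x - 1))\<^sup>2" using \<open>cos x \<le> 1 / 2\<close> by simp
  then show ?thesis by (rule power2_le_imp_le) simp
qed

text \<open>Take \<open>s = 2 * pi * x\<close> with \<open>x\<close> slightly above
  \<open>1 / q K\<close>. Frequencies from \<open>K\<close> on have \<open>q k * x\<close> near an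
  integer by construction; earlier ones have \<open>q k * x\<close> near 0 because they are far
  smaller than \<open>q K\<close>. The integer \<open>q K div 2\<close> has neither property, as it
  sends \<open>x\<close> near 1/2.\<close>

lemma shift_almost_fixing_frequencies:
  fixes q :: "nat \<Rightarrow> nat"
  assumes mono: "strict_mono_on {1..} q" and pos: "\<And>k. k \<ge> 1 \<Longrightarrow> q k > 0"
    and lim: "filterlim (\<lambda>k. real (q (Suc k)) / real (q k)) at_top sequentially" and \<epsilon>: "\<epsilon> > 0"
  shows "\<exists>s n. 0 < s \<and> s < \<epsilon> \<and> n \<ge> 1 \<and> 1 \<le> norm (cis (real n * s) - 1)
     \<and> (\<forall>k\<ge>1. norm (cis (real (q k) * s) - 1) \<le> \<epsilon>)"
proof -
  \<comment> \<open>The 8 places \<open>q K * x\<close> in \<open>[1, 5/4]\<close> and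
    \<open>n * x\<close> in \<open>[7/16, 5/8]\<close>, so \<open>n * s\<close> stays away from
    multiples of \<open>2 * pi\<close>. The other entry makes the error
    \<open>2 * pi * (4 / R)\<close> at most \<epsilon>.\<close>
  define R where "R = max 8 (8 * pi / \<epsilon>)"
  have R: "R \<ge> 8" "8 * pi / R \<le> \<epsilon>" using \<epsilon> by (auto simp: R_def field_simps max_def)
  have "\<forall>\<^sub>F k in sequentially. R \<le> real (q (Suc k)) / real (q k)"
    using lim unfolding filterlim_at_top by blast
  then obtain K0 where K0: "\<And>k. k \<ge> K0 \<Longrightarrow> R \<le> real (q (Suc k)) / real (q k)"
    unfolding eventually_sequentially by blast
  define J where "J = max 1 K0"
  \<comment> \<open>Starting one index later ensures that every frequency before \<open>K\<close> is
    at most \<open>q J\<close>, a factor \<open>R\<close> below \<open>q K\<close>.\<close>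
  define K where "K = Suc J"
  have ratio: "R * real (q k) \<le> real (q (Suc k))" if "k \<ge> J" for k
    using K0[of k] pos[of k] that by (simp add: J_def field_simps)
  have qJ: "1 \<le> real (q J)" using pos[of J] by (simp add: J_def)
  have qK: "R \<le> real (q K)"
    using ratio[of J] mult_left_mono[OF qJ, of R] R unfolding K_def by linarith
  then have qKpos: "q K > 0" "8 \<le> real (q K)" using R by auto
  obtain x where x: "1 / real (q K) \<le> x" "\<And>k. k \<ge> K \<Longrightarrow> \<exists>m::int. \<bar>real (q k) * x - of_int m\<bar> \<le> 2 / R"
    "real (q K) * x - 1 \<le> 2 / R"
    using simultaneous_approximation[of q K R] qKpos R ratio by (auto simp: K_def)
  define s where "s = 2 * pi * x"
  have xpos: "0 < x" using x(1) qKpos by (intro less_le_trans[OF _ x(1)]) simp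
  have x1: "1 \<le> real (q K) * x" using x(1) qKpos by (simp add: field_simps)
  have x5: "real (q K) * x \<le> 5 / 4"
  proof -
    have "2 / R \<le> 1 / 4" using R by (simp add: field_simps)
    then show ?thesis using x(3) by simp
  qed
  define n where "n = q K div 2"
  have n: "real n \<le> real (q K) / 2" "real (q K) / 2 - 1 / 2 \<le> real n" unfolding n_def by linarith+
  show ?thesis
  proof (intro exI conjI allI impI)
    show "0 < s" using xpos by (simp add: s_def)
    have "R * x \<le> real (q K) * x" using qK xpos by (intro mult_right_mono) auto
    then have "x \<le> (5 / 4) / R" using x5 R by (simp add: field_simps)
    then have "s \<le> 2 * pi * ((5 / 4) / R)" unfolding s_def by (intro mult_left_mono) auto
    also have "\<dots> < 8 * pi / R" using R by (simp add: field_simps)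
    finally show "s < \<epsilon>" using R by simp
    show "n \<ge> 1" using qKpos by (simp add: n_def)
    show "1 \<le> norm (cis (real n * s) - 1)"
    proof (rule norm_cis_minus_one_ge)
      have "real n * x \<le> real (q K) / 2 * x" using n xpos by (intro mult_right_mono) auto
      then have "real n * x \<le> 5 / 8" using x5 by simp
      then have "2 * pi * (real n * x) \<le> 2 * pi * (5 / 8)" by (intro mult_left_mono) auto
      then show "real n * s \<le> 5 * pi / 3" unfolding s_def using pi_gt_zero by (simp add: mult_ac)
      have "real (q K) * 7 / 16 \<le> real n" using n qKpos by linarith
      then have "real (q K) * 7 / 16 * x \<le> real n * x" using xpos by (intro mult_right_mono) auto
      then have "7 / 16 \<le> real n * x" using x1 by simp
      then have "2 * pi * (7 / 16) \<le> 2 * pi * (real n * x)" by (intro mult_left_mono) auto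
      then show "pi / 3 \<le> real n * s" unfolding s_def using pi_gt_zero by (simp add: mult_ac)
    qed
    fix k :: nat assume k: "1 \<le> k"
    have "\<exists>m::int. \<bar>real (q k) * x - of_int m\<bar> \<le> 4 / R"
    proof (cases "k \<ge> K")
      case True
      then obtain m :: int where "\<bar>real (q k) * x - of_int m\<bar> \<le> 2 / R" using x(2) by blast
      moreover have "2 / R \<le> 4 / R" using R by (intro divide_right_mono) auto
      ultimately show ?thesis by (intro exI[of _ m]) linarith
    next
      case False
      then have "q k \<le> q J" using k by (intro strict_mono_on_leD[OF mono]) (auto simp: K_def J_def)
      then have "R * real (q k) \<le> R * real (q J)" using R by simp
      also have "\<dots> \<le> real (q K)" using ratio[of J] by (simp add: K_def)
      finally have "R * real (q k) * x \<le> real (q K) * x" using xpos by (intro mult_right_mono) auto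
      then have "real (q k) * x \<le> 4 / R" using x5 R by (simp add: field_simps)
      then show ?thesis using xpos by (intro exI[of _ 0]) simp
    qed
    then obtain m :: int where m: "\<bar>real (q k) * x - of_int m\<bar> \<le> 4 / R" by blast
    have "norm (cis (real (q k) * s) - 1) \<le> \<bar>2 * pi * (real (q k) * x - of_int m)\<bar>"
      using norm_cis_minus_one_le[of "real (q k) * s" m] by (simp add: s_def algebra_simps)
    also have "\<dots> \<le> 2 * pi * (4 / R)" unfolding abs_mult using m by (intro mult_mono) auto
    also have "\<dots> \<le> \<epsilon>" using R by simp
    finally show "norm (cis (real (q k) * s) - 1) \<le> \<epsilon>" .
  qed
qed

section \<open>Exceptional sets\<close>

text \<open>Dominated convergence of indicators. It stands in for Egorov's theorem, both for the
  boundedness of partial sums and for their closeness to the limit.\<close>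

lemma (in finite_measure) measure_tendsto_0_of_AE:
  assumes A: "\<And>n. A n \<in> sets M" and ev: "AE x in M. \<forall>\<^sub>F n in sequentially. x \<notin> A n"
  shows "(\<lambda>n. measure M (A n)) \<longlonglongrightarrow> 0"
proof -
  have "(\<lambda>n. \<integral>x. indicat_real (A n) x \<partial>M) \<longlonglongrightarrow> (\<integral>x. 0 \<partial>M)"
  proof (rule integral_dominated_convergence[where w = "\<lambda>_. 1"])
    show "AE x in M. (\<lambda>n. indicat_real (A n) x) \<longlonglongrightarrow> 0"
      using ev
    proof eventually_elim
      case (elim x)
      show ?case
        by (rule tendsto_eventually) (use elim in \<open>auto elim!: eventually_mono\<close>)
    qed
  qed (use A in \<open>auto simp: indicator_def\<close>)
  then show ?thesis using A by simp
qed

lemma sets_circle_measure_iff: "X \<in> sets circle_measure \<longleftrightarrow> X \<subseteq> {0..2*pi} \<and> X \<in> sets lebesgue"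
proof -
  have "{0..2*pi} \<inter> space lebesgue \<in> sets lebesgue" by simp
  from sets_restrict_space_iff[OF this] show ?thesis by (simp only: circle_measure_def)
qed

lemma measure_circle_measure_eq:
  "X \<in> sets circle_measure \<Longrightarrow> measure circle_measure X = measure lebesgue X"
  unfolding sets_circle_measure_iff unfolding circle_measure_def
  by (subst measure_restrict_space) auto

lemma sets_circle_imp_lmeasurable: "X \<in> sets circle_measure \<Longrightarrow> X \<in> lmeasurable"
  unfolding sets_circle_measure_iff by (rule fmeasurableI2[of "{0..2*pi}"]) auto

text \<open>Three translates of one period cover \<open>[-2 * pi, 4 * pi]\<close>. The crude factor
  3 is affordable because the exceptional sets can be made as small as desired.\<close>

lemma periodic_set_measure_le:
  fixes P :: "real \<Rightarrow> bool"
  assumes per: "\<And>t. P (t + 2 * pi) = P t" and A: "{t\<in>{0..2*pi}. P t} \<in> lmeasurable"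
    and ab: "- 2 * pi \<le> a" "b \<le> 4 * pi"
  shows "{t\<in>{a..b}. P t} \<in> lmeasurable"
    and "measure lebesgue {t\<in>{a..b}. P t} \<le> 3 * measure lebesgue {t\<in>{0..2*pi}. P t}"
proof -
  define A where "A = {t\<in>{0..2*pi}. P t}"
  define U where "U = A \<union> ((+) (2 * pi) ` A \<union> (+) (- 2 * pi) ` A)"
  have A': "A \<in> lmeasurable" using A by (simp add: A_def)
  have per': "P (t - 2 * pi) = P t" for t using per[of "t - 2 * pi"] by simp
  have eq: "{t\<in>{a..b}. P t} = {a..b} \<inter> U"
  proof (intro equalityI subsetI)
    fix t assume t: "t \<in> {t\<in>{a..b}. P t}"
    consider "0 \<le> t" "t \<le> 2 * pi" | "t < 0" | "t > 2 * pi" by linarith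
    then show "t \<in> {a..b} \<inter> U"
    proof cases
      case 1
      then show ?thesis using t by (auto simp: U_def A_def)
    next
      case 2
      then have "t + 2 * pi \<in> A" using t ab by (auto simp: A_def per)
      then have "- 2 * pi + (t + 2 * pi) \<in> (+) (- 2 * pi) ` A" by (rule imageI)
      then show ?thesis using t by (auto simp: U_def)
    next
      case 3
      then have "t - 2 * pi \<in> A" using t ab by (auto simp: A_def per')
      then have "2 * pi + (t - 2 * pi) \<in> (+) (2 * pi) ` A" by (rule imageI)
      then show ?thesis using t by (auto simp: U_def)
    qed
  next
    fix t assume "t \<in> {a..b} \<inter> U"
    then show "t \<in> {t\<in>{a..b}. P t}"
      using per per' by (auto simp: U_def A_def add.commute)
  qed
  have tr: "(+) x ` A \<in> lmeasurable" "measure lebesgue ((+) x ` A) = measure lebesgue A" for x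
    using A' by (auto simp: measurable_translation measure_translation)
  have U: "U \<in> lmeasurable" unfolding U_def by (intro fmeasurable.Un A' tr)
  show 1: "{t\<in>{a..b}. P t} \<in> lmeasurable"
    unfolding eq using U by (intro fmeasurable.Int) auto
  have "measure lebesgue {t\<in>{a..b}. P t} \<le> measure lebesgue U"
    by (rule measure_mono_fmeasurable[OF _ fmeasurableD[OF 1] U]) (use eq in blast)
  also have "\<dots> \<le> measure lebesgue A + (measure lebesgue ((+) (2 * pi) ` A) + measure lebesgue ((+) (- 2 * pi) ` A))"
    unfolding U_def
    by (intro order_trans[OF measure_Un_le] add_left_mono measure_Un_le fmeasurableD fmeasurable.Un A' tr order_refl)
  finally show "measure lebesgue {t\<in>{a..b}. P t} \<le> 3 * measure lebesgue {t\<in>{0..2*pi}. P t}"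
    by (simp only: tr A_def[symmetric])
qed

lemma periodic_set_shift_measure_le:
  fixes P :: "real \<Rightarrow> bool"
  assumes per: "\<And>t. P (t + 2 * pi) = P t" and A: "{t\<in>{0..2*pi}. P t} \<in> lmeasurable"
    and s: "0 \<le> s" "s \<le> 2 * pi"
  shows "{t\<in>{0..2*pi}. P (t + s)} \<in> lmeasurable"
    and "measure lebesgue {t\<in>{0..2*pi}. P (t + s)} \<le> 3 * measure lebesgue {t\<in>{0..2*pi}. P t}"
proof -
  have eq: "{t\<in>{0..2*pi}. P (t + s)} = (+) (- s) ` {t\<in>{s..2*pi+s}. P t}"
  proof (intro equalityI subsetI)
    fix t assume "t \<in> {t\<in>{0..2*pi}. P (t + s)}"
    then have "t + s \<in> {t\<in>{s..2*pi+s}. P t}" by auto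
    then have "- s + (t + s) \<in> (+) (- s) ` {t\<in>{s..2*pi+s}. P t}" by (rule imageI)
    then show "t \<in> (+) (- s) ` {t\<in>{s..2*pi+s}. P t}" by simp
  qed auto
  have "{t\<in>{s..2*pi+s}. P t} \<in> lmeasurable"
    "measure lebesgue {t\<in>{s..2*pi+s}. P t} \<le> 3 * measure lebesgue {t\<in>{0..2*pi}. P t}"
    using s by (intro periodic_set_measure_le[OF per A]; simp)+
  then show "{t\<in>{0..2*pi}. P (t + s)} \<in> lmeasurable"
    "measure lebesgue {t\<in>{0..2*pi}. P (t + s)} \<le> 3 * measure lebesgue {t\<in>{0..2*pi}. P t}"
    unfolding eq by (simp_all only: measurable_translation measure_translation)
qed

lemma AE_circle_shift:
  fixes P :: "real \<Rightarrow> bool"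
  assumes per: "\<And>t. P (t + 2 * pi) = P t" and P: "AE t in circle_measure. P t"
    and s: "0 \<le> s" "s \<le> 2 * pi"
  shows "AE t in circle_measure. P (t + s)"
proof -
  have null: "(AE t in circle_measure. Q t) \<longleftrightarrow> {t\<in>{0..2*pi}. \<not> Q t} \<in> null_sets lebesgue" for Q
  proof -
    have "(AE t in circle_measure. Q t) \<longleftrightarrow> (AE t in lebesgue. t \<in> {0..2*pi} \<longrightarrow> Q t)"
      unfolding circle_measure_def by (subst AE_restrict_space_iff) auto
    also have "\<dots> \<longleftrightarrow> {t\<in>{0..2*pi}. \<not> Q t} \<in> null_sets lebesgue"
    proof -
      have "{t \<in> space lebesgue. \<not> (t \<in> {0..2*pi} \<longrightarrow> Q t)} = {t\<in>{0..2*pi}. \<not> Q t}" by auto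
      then show ?thesis by (simp only: completion.AE_iff_null_sets)
    qed
    finally show ?thesis .
  qed
  have A: "{t\<in>{0..2*pi}. \<not> P t} \<in> lmeasurable" "measure lebesgue {t\<in>{0..2*pi}. \<not> P t} = 0"
    using P unfolding null negligible_iff_null_sets[symmetric]
    by (auto intro: negligible_imp_measurable negligible_imp_measure0)
  have "{t\<in>{0..2*pi}. \<not> P (t + s)} \<in> lmeasurable" "measure lebesgue {t\<in>{0..2*pi}. \<not> P (t + s)} \<le> 0"
    using periodic_set_shift_measure_le[of "\<lambda>t. \<not> P t" s] per A s by auto
  then have "negligible {t\<in>{0..2*pi}. \<not> P (t + s)}"
    by (simp add: negligible_iff_measure measure_le_0_iff)
  then show ?thesis unfolding null negligible_iff_null_sets .
qed

lemma suminf_dominant_term: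
  fixes b :: "nat \<Rightarrow> complex"
  assumes head: "\<And>i. i < j \<Longrightarrow> norm (b i) \<le> x i" and tail: "\<And>i. norm (b (i + Suc j)) \<le> y * (1/2) ^ i"
  shows "norm (suminf b - b j) \<le> (\<Sum>i<j. x i) + 2 * y"
proof -
  have geo: "(\<lambda>i. y * (1/2) ^ i) sums (y * 2)"
    using geometric_sums[of "1/2 :: real"] by (intro sums_mult) simp
  have sumtail: "summable (\<lambda>i. norm (b (i + Suc j)))"
    using geo tail by (intro summable_comparison_test'[OF sums_summable[OF geo]]) auto
  then have sum: "summable b" using summable_norm_cancel summable_iff_shift by blast
  have "suminf b = (\<Sum>i. b (i + Suc j)) + (\<Sum>i<Suc j. b i)"
    by (rule suminf_split_initial_segment[OF sum])
  then have "suminf b - b j = (\<Sum>i. b (i + Suc j)) + (\<Sum>i<j. b i)" by simp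
  also have "norm \<dots> \<le> norm (\<Sum>i. b (i + Suc j)) + norm (\<Sum>i<j. b i)" by (rule norm_triangle_ineq)
  also have "norm (\<Sum>i<j. b i) \<le> (\<Sum>i<j. x i)" using head by (intro sum_norm_le) auto
  also have "norm (\<Sum>i. b (i + Suc j)) \<le> (\<Sum>i. norm (b (i + Suc j)))" by (rule summable_norm[OF sumtail])
  also have "\<dots> \<le> (\<Sum>i. y * (1/2) ^ i)" by (rule suminf_le[OF tail sumtail sums_summable[OF geo]])
  also have "\<dots> = 2 * y" using geo by (simp add: sums_iff)
  finally show ?thesis by simp
qed

text \<open>Differencing with step \<open>s\<close> removes \<open>H\<close> up to \<rho>^3 off a
  small set and leaves one exponential of \<open>f\<close>. Multiplying by
  \<open>cis (n * t)\<close> and dividing by \<open>\<rho> * \<kappa>\<close> turns that exponential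
  into 1 and the partial sums of the power series into those of a series without constant term, to
  which the quantitative Privalov theorem applies. The conclusion has size O(\<rho>) on the right,
  so it fails for small \<rho> once \<open>M\<close> is fixed.\<close>

lemma power_series_key_estimate:
  fixes c :: "nat \<Rightarrow> complex" and f H :: "real \<Rightarrow> complex" and \<kappa> :: complex and M \<rho> s :: real
  defines "D N t \<equiv> (\<Sum>k<N. c k * cis t ^ k)"
  assumes s: "0 \<le> s" "s \<le> 2 * pi" and n: "n \<ge> 1" and \<rho>: "0 < \<rho>" "8 * \<rho>\<^sup>2 \<le> 1" and \<kappa>: "norm \<kappa> \<ge> 1" and M: "M \<ge> 0"
    and conv: "AE t in circle_measure. (\<lambda>N. D N t) \<longlonglongrightarrow> f t - H t"
    and perf: "\<And>t. f (t + 2 * pi) = f t" and perH: "\<And>t. H (t + 2 * pi) = H t"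
    and EM: "measure lebesgue {t\<in>{0..2*pi}. \<exists>N. norm (D N t) > M} < 1/6000"
    and fm: "(\<lambda>t. f (t + s) - f t) \<in> borel_measurable circle_measure"
    and f: "\<And>t. norm (f (t + s) - f t - \<rho> * \<kappa> * cis (- (real n * t))) \<le> 5 * \<rho> ^ 3"
    and Hm: "(\<lambda>t. H (t + s) - H t) \<in> borel_measurable circle_measure"
    and H: "measure circle_measure {t\<in>{0..2*pi}. norm (H (t + s) - H t) > \<rho> ^ 3} < 1/6000"
  shows "1 \<le> 8 * \<rho>\<^sup>2 * (3 * ((2 * M + 1) / \<rho>) + 1)"
proof -
  interpret finite_measure circle_measure by (rule finite_measure_circle_measure)
  define P where "P t \<longleftrightarrow> (\<exists>N. norm (D N t) > M)" for t
  define \<Delta> where "\<Delta> N t = D N (t + s) - D N t" for N t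
  define A where "A N = {t\<in>space circle_measure. norm (\<Delta> N t - ((f (t + s) - f t) - (H (t + s) - H t))) > \<rho> ^ 3}" for N
  have cis2: "cis (t + 2 * pi) = cis t" for t by (simp flip: cis_mult)
  have perD: "D N (t + 2 * pi) = D N t" for N t unfolding D_def cis2 ..
  have contD: "continuous_on S (\<lambda>t. D N (t + a))" for N a S unfolding D_def by (intro continuous_intros)
  have contD0: "continuous_on S (D N)" for N S using contD[of S N 0] by simp
  have D\<Delta>m: "\<Delta> N \<in> borel_measurable circle_measure" for N
    unfolding \<Delta>_def using contD contD0
    by (intro borel_measurable_integrable integrable_circle_continuous continuous_on_diff)
  have Am: "A N \<in> sets circle_measure" for N
    unfolding A_def using D\<Delta>m[of N] fm Hm by measurable
  have conv_s: "AE t in circle_measure. (\<lambda>N. D N (t + s)) \<longlonglongrightarrow> f (t + s) - H (t + s)"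
    by (rule AE_circle_shift[OF _ conv s]) (simp add: perD perf perH)
  have "(\<lambda>N. measure circle_measure (A N)) \<longlonglongrightarrow> 0"
  proof (rule measure_tendsto_0_of_AE[OF Am])
    show "AE t in circle_measure. \<forall>\<^sub>F N in sequentially. t \<notin> A N"
      using conv conv_s
    proof eventually_elim
      case (elim t)
      have "(\<lambda>N. \<Delta> N t) \<longlonglongrightarrow> (f (t + s) - H (t + s)) - (f t - H t)"
        unfolding \<Delta>_def by (intro tendsto_diff elim)
      then have "(\<lambda>N. \<Delta> N t - ((f (t + s) - f t) - (H (t + s) - H t))) \<longlonglongrightarrow> 0"
        by (intro LIM_zero) (simp add: algebra_simps)
      then have "(\<lambda>N. norm (\<Delta> N t - ((f (t + s) - f t) - (H (t + s) - H t)))) \<longlonglongrightarrow> 0"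
        by (rule tendsto_norm_zero)
      then have "\<forall>\<^sub>F N in sequentially. norm (\<Delta> N t - ((f (t + s) - f t) - (H (t + s) - H t))) < \<rho> ^ 3"
        by (rule order_tendstoD) (use \<rho> in simp)
      then show ?case by eventually_elim (simp add: A_def)
    qed
  qed
  then have "\<forall>\<^sub>F N in sequentially. measure circle_measure (A N) < 1/6000"
    by (rule order_tendstoD) simp
  then obtain N where N: "measure circle_measure (A N) < 1/6000"
    unfolding eventually_sequentially by blast
  \<comment> \<open>Both are slightly larger than the estimates \<open>2 * M / \<rho>\<close> and
    \<open>7 * \<rho>\<^sup>2\<close> proved below, because the bad set is defined by non-strict
    inequalities so as to be closed.\<close>
  define B \<epsilon> where "B = (2 * M + 1) / \<rho>" and "\<epsilon> = 8 * \<rho>\<^sup>2"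
  define d where "d k = (if k < n then 0 else c (k - n) * (cis (real (k - n) * s) - 1) / (\<rho> * \<kappa>))" for k
  have \<kappa>0: "\<kappa> \<noteq> 0" using \<kappa> by auto
  have dsum: "(\<Sum>k<m. d k * cis t ^ k) = cis (real n * t) * \<Delta> (m - n) t / (\<rho> * \<kappa>)" for m t
  proof (cases "n \<le> m")
    case False
    then have "(\<Sum>k<m. d k * cis t ^ k) = 0" by (intro sum.neutral) (auto simp: d_def)
    then show ?thesis using False by (simp add: \<Delta>_def D_def)
  next
    case True
    have "(\<Sum>k<m. d k * cis t ^ k) = (\<Sum>k\<in>{n..<m}. d k * cis t ^ k)"
      by (rule sum.mono_neutral_right) (auto simp: d_def)
    also have "\<dots> = (\<Sum>k<m - n. d (k + n) * cis t ^ (k + n))"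
      using sum.shift_bounds_nat_ivl[of "\<lambda>k. d k * cis t ^ k" 0 n "m - n"] True by (simp add: atLeast0LessThan)
    also have "\<dots> = (\<Sum>k<m - n. cis (real n * t) / (\<rho> * \<kappa>) * (c k * cis (t + s) ^ k - c k * cis t ^ k))"
    proof (intro sum.cong refl)
      fix k
      have "cis (t + s) ^ k = cis (real k * s) * cis t ^ k"
        unfolding Complex.DeMoivre cis_mult by (simp add: distrib_left add.commute)
      moreover have "cis t ^ (k + n) = cis (real n * t) * cis t ^ k" by (simp add: power_add Complex.DeMoivre)
      ultimately show "d (k + n) * cis t ^ (k + n) = cis (real n * t) / (\<rho> * \<kappa>) * (c k * cis (t + s) ^ k - c k * cis t ^ k)"
        by (simp add: d_def right_diff_distrib left_diff_distrib diff_divide_distrib mult_ac)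
    qed
    also have "\<dots> = cis (real n * t) / (\<rho> * \<kappa>) * \<Delta> (m - n) t"
      by (simp only: \<Delta>_def D_def sum_subtractf flip: sum_distrib_left)
    finally show ?thesis by simp
  qed
  have d0: "d 0 = 0" using n by (simp add: d_def)
  \<comment> \<open>The new series is delayed by \<open>n\<close> places, so length
    \<open>N + n\<close> corresponds to \<open>\<Delta> N\<close>; for \<open>m < n\<close> the
    truncated difference \<open>m - n\<close> is 0 and the partial sum vanishes.\<close>
  define bad where "bad t \<longleftrightarrow> (\<exists>m\<le>N + n. B \<le> norm (\<Sum>k<m. d k * cis t ^ k)) \<or> \<epsilon> \<le> norm ((\<Sum>k<N + n. d k * cis t ^ k) - 1)" for t
  have n\<rho>\<kappa>: "norm (\<rho> * \<kappa>) \<ge> \<rho>" using \<kappa> \<rho> by (simp add: norm_mult)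
  have norm_div: "norm (x / (\<rho> * \<kappa>)) \<le> norm x / \<rho>" for x :: complex
    unfolding norm_divide
    by (rule divide_left_mono[OF n\<rho>\<kappa> norm_ge_zero mult_pos_pos[OF less_le_trans[OF \<rho>(1) n\<rho>\<kappa>] \<rho>(1)]])
  have bad: "P t \<or> P (t + s) \<or> norm (\<Delta> N t - ((f (t + s) - f t) - (H (t + s) - H t))) > \<rho> ^ 3
      \<or> norm (H (t + s) - H t) > \<rho> ^ 3" if "bad t" for t
  proof (rule ccontr)
    assume no: "\<not> ?thesis"
    then have bd: "norm (D m t) \<le> M" "norm (D m (t + s)) \<le> M" for m unfolding P_def by (meson not_le)+
    have 1: "norm (\<Sum>k<m. d k * cis t ^ k) < B" for m
    proof -
      have "norm (\<Sum>k<m. d k * cis t ^ k) \<le> norm (cis (real n * t) * \<Delta> (m - n) t) / \<rho>"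
        unfolding dsum by (rule norm_div)
      also have "norm (cis (real n * t) * \<Delta> (m - n) t) \<le> 2 * M"
        using norm_triangle_ineq4[of "D (m - n) (t + s)" "D (m - n) t"] bd[of "m - n"] by (simp add: norm_mult \<Delta>_def)
      finally have "norm (\<Sum>k<m. d k * cis t ^ k) \<le> 2 * M / \<rho>" using \<rho> by (simp add: divide_right_mono)
      also have "\<dots> < B" unfolding B_def using \<rho> by (intro divide_strict_right_mono) auto
      finally show ?thesis .
    qed
    have 2: "norm ((\<Sum>k<N + n. d k * cis t ^ k) - 1) < \<epsilon>"
    proof -
      have one: "cis (real n * t) * cis (- (real n * t)) = 1" by (simp add: cis_mult)
      have "(\<Sum>k<N + n. d k * cis t ^ k) - 1 = cis (real n * t) * (\<Delta> N t - \<rho> * \<kappa> * cis (- (real n * t))) / (\<rho> * \<kappa>)"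
      proof -
        have "cis (real n * t) * (\<rho> * \<kappa> * cis (- (real n * t))) = \<rho> * \<kappa>" using one by (simp add: mult_ac)
        then show ?thesis unfolding dsum using \<kappa>0 \<rho> by (simp add: right_diff_distrib diff_divide_distrib)
      qed
      also have "norm \<dots> \<le> norm (cis (real n * t) * (\<Delta> N t - \<rho> * \<kappa> * cis (- (real n * t)))) / \<rho>" by (rule norm_div)
      \<comment> \<open>One \<rho>^3 comes from truncating the series, one from \<open>H\<close>,
        and five from the other terms of \<open>f\<close>.\<close>
      also have "norm (cis (real n * t) * (\<Delta> N t - \<rho> * \<kappa> * cis (- (real n * t)))) \<le> 7 * \<rho> ^ 3"
      proof -
        define a1 a2 a3 where "a1 = \<Delta> N t - ((f (t + s) - f t) - (H (t + s) - H t))"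
          and "a2 = H (t + s) - H t" and "a3 = f (t + s) - f t - \<rho> * \<kappa> * cis (- (real n * t))"
        have "\<Delta> N t - \<rho> * \<kappa> * cis (- (real n * t)) = a1 - a2 + a3" by (simp add: a1_def a2_def a3_def)
        moreover have "norm (a1 - a2 + a3) \<le> norm a1 + norm a2 + norm a3"
          by (meson add_right_mono norm_triangle_ineq norm_triangle_ineq4 order_trans)
        moreover have "norm a1 \<le> \<rho> ^ 3" "norm a2 \<le> \<rho> ^ 3" using no by (auto simp: a1_def a2_def)
        moreover have "norm a3 \<le> 5 * \<rho> ^ 3" unfolding a3_def by (rule f)
        ultimately show ?thesis by (simp add: norm_mult)
      qed
      finally have "norm ((\<Sum>k<N + n. d k * cis t ^ k) - 1) \<le> 7 * \<rho> ^ 3 / \<rho>" using \<rho> by (simp add: divide_right_mono)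
      also have "\<dots> < \<epsilon>" using \<rho> by (simp add: \<epsilon>_def power2_eq_square power3_eq_cube)
      finally show ?thesis .
    qed
    show False using that 1 2 unfolding bad_def by (meson not_le)
  qed
  have perbad: "bad (t + 2 * pi) = bad t" for t unfolding bad_def cis2 ..
  have perP: "P (t + 2 * pi) = P t" for t unfolding P_def perD ..
  have Pm: "{t\<in>{0..2*pi}. P t} \<in> lmeasurable"
  proof -
    have "{t\<in>{0..2*pi}. P t} = {0..2*pi} \<inter> (\<Union>N. {t. M < norm (D N t)})" by (auto simp: P_def)
    moreover have "open (\<Union>N. {t. M < norm (D N t)})"
      by (intro open_UN ballI open_Collect_less continuous_intros contD0)
    ultimately show ?thesis by (simp add: fmeasurable_Int_fmeasurable borel_open)
  qed
  note Ps = periodic_set_shift_measure_le[OF perP Pm s]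
  have badm: "{t\<in>{0..2*pi}. bad t} \<in> lmeasurable"
  proof -
    have "{t\<in>{0..2*pi}. bad t} = {0..2*pi} \<inter> ((\<Union>m\<in>{..N + n}. {t. B \<le> norm (\<Sum>k<m. d k * cis t ^ k)})
        \<union> {t. \<epsilon> \<le> norm ((\<Sum>k<N + n. d k * cis t ^ k) - 1)})" by (auto simp: bad_def)
    moreover have "closed ((\<Union>m\<in>{..N + n}. {t. B \<le> norm (\<Sum>k<m. d k * cis t ^ k)})
        \<union> {t. \<epsilon> \<le> norm ((\<Sum>k<N + n. d k * cis t ^ k) - 1)})"
      by (intro closed_Un closed_UN finite_atMost ballI closed_Collect_le continuous_intros)
    ultimately have "compact {t\<in>{0..2*pi}. bad t}" using compact_Int_closed[OF compact_Icc] by simp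
    then show ?thesis by (rule lmeasurable_compact)
  qed
  define E where "E = {t\<in>space circle_measure. norm (H (t + s) - H t) > \<rho> ^ 3}"
  have Em: "E \<in> sets circle_measure" unfolding E_def using Hm by measurable
  note meas = sets_circle_imp_lmeasurable[OF Am[of N]] sets_circle_imp_lmeasurable[OF Em]
  have sub: "{t\<in>{0..2*pi}. bad t} \<subseteq> {t\<in>{0..2*pi}. P t} \<union> ({t\<in>{0..2*pi}. P (t + s)} \<union> (A N \<union> E))"
    using bad unfolding A_def E_def space_circle_measure by blast
  have "measure lebesgue {t\<in>{0..2*pi}. bad t}
      \<le> measure lebesgue ({t\<in>{0..2*pi}. P t} \<union> ({t\<in>{0..2*pi}. P (t + s)} \<union> (A N \<union> E)))"
    by (intro measure_mono_fmeasurable[OF sub fmeasurableD[OF badm]] fmeasurable.Un Pm Ps(1) meas)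
  also have "\<dots> \<le> measure lebesgue {t\<in>{0..2*pi}. P t} + (measure lebesgue {t\<in>{0..2*pi}. P (t + s)}
       + (measure lebesgue (A N) + measure lebesgue E))"
    by (intro order_trans[OF measure_Un_le] add_left_mono measure_Un_le fmeasurableD fmeasurable.Un Pm Ps(1) meas order_refl)
  \<comment> \<open>In units of 1/6000 the four sets contribute at most 1, 3, 1 and 1, the 3 coming
    from the shifted copy. Passing to the longer interval costs another factor 3 and ends at
    1/200.\<close>
  also have "\<dots> < 1/600"
    using EM Ps(2) N H Am[of N] Em by (simp add: P_def[symmetric] measure_circle_measure_eq E_def)
  finally have "measure lebesgue {t\<in>{0..2*pi}. bad t} < 1/600" .
  moreover have "measure lebesgue {t\<in>{-1..2*pi+1}. bad t} \<le> 3 * measure lebesgue {t\<in>{0..2*pi}. bad t}"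
    by (rule periodic_set_measure_le(2)[OF perbad badm]) (use pi_gt3 in auto)
  ultimately have "measure lebesgue {t\<in>{-1..2*pi+1}. bad t} < 1/200" by simp
  moreover have "0 < \<epsilon>" "\<epsilon> \<le> 1" "0 < B" using \<rho> M by (auto simp: \<epsilon>_def B_def)
  ultimately have "1 \<le> \<epsilon> * (3 * B + 1)"
    using quantitative_Privalov[of d \<epsilon> B "N + n"] d0 unfolding bad_def by blast
  then show ?thesis by (simp add: \<epsilon>_def B_def)
qed

section \<open>The function that is not representable\<close>

text \<open>Each value is the cube of the previous one, so the terms after the \<open>j\<close>-th
  add up to O of the cube of the \<open>j\<close>-th: negligible even after division by the
  \<open>j\<close>-th and multiplication by a bound of order its inverse.\<close>

definition super_geometric :: "nat \<Rightarrow> real" where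
  "super_geometric j = (1/2) ^ (3 ^ j)"

lemma super_geometric_Suc: "super_geometric (Suc j) = super_geometric j ^ 3"
  by (simp add: super_geometric_def mult.commute flip: power_mult)

lemma super_geometric_bounds: "0 < super_geometric j" "super_geometric j \<le> 1 / 2"
proof -
  show "0 < super_geometric j" by (simp add: super_geometric_def)
  have "(1/2 :: real) ^ (3 ^ j) \<le> (1/2) ^ 1" by (rule power_decreasing) auto
  then show "super_geometric j \<le> 1 / 2" by (simp add: super_geometric_def)
qed

lemma super_geometric_tail: "super_geometric (j + i) \<le> super_geometric j * (1/2) ^ i"
proof (induction i)
  case (Suc i)
  define x where "x = super_geometric (j + i)"
  have x: "0 < x" "x \<le> 1 / 2" using super_geometric_bounds by (auto simp: x_def)
  have "super_geometric (j + Suc i) = x * (x * x)"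
    by (simp add: super_geometric_Suc x_def power3_eq_cube)
  also have "\<dots> \<le> x * ((1/2) * 1)" using x by (intro mult_left_mono mult_mono) auto
  also have "\<dots> \<le> (super_geometric j * (1/2) ^ i) * (1/2)" using Suc.IH by (simp add: x_def)
  finally show ?case by simp
qed simp

lemma super_geometric_tendsto: "super_geometric \<longlonglongrightarrow> 0"
proof (rule tendsto_sandwich[where f = "\<lambda>_. 0"])
  show "\<forall>\<^sub>F j in sequentially. super_geometric j \<le> super_geometric 0 * (1/2) ^ j"
    using super_geometric_tail[of 0] by (intro always_eventually allI) simp
  have "(\<lambda>j. super_geometric 0 * (1/2) ^ j) \<longlonglongrightarrow> super_geometric 0 * 0"
    by (intro tendsto_mult_left LIMSEQ_power_zero) auto
  then show "(\<lambda>j. super_geometric 0 * (1/2) ^ j) \<longlonglongrightarrow> 0" by simp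
  show "\<forall>\<^sub>F j in sequentially. 0 \<le> super_geometric j"
    using super_geometric_bounds(1) by (intro always_eventually allI less_imp_le)
qed simp

text \<open>Earlier terms vary by at most \<open>n i * s\<close>, which the smallness of
  \<open>s\<close> bounds by one cube in total. Later terms are bounded by twice their coefficients,
  whose sum is at most two cubes. This gives \<open>1 + 4 = 5\<close>.\<close>

lemma lacunary_series_difference:
  fixes n :: "nat \<Rightarrow> nat"
  assumes s: "0 \<le> s" "(1 + (\<Sum>i<j. real (n i))) * s \<le> super_geometric j ^ 4"
  defines "f \<equiv> \<lambda>t. \<Sum>i. super_geometric i * cis (- (real (n i) * t))"
  shows "norm (f (t + s) - f t - super_geometric j * (cis (- (real (n j) * s)) - 1) * cis (- (real (n j) * t)))
     \<le> 5 * super_geometric j ^ 3"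
proof -
  let ?\<rho> = super_geometric
  define b where "b i = ?\<rho> i * (cis (- (real (n i) * s)) - 1) * cis (- (real (n i) * t))" for i
  have "summable (\<lambda>i. ?\<rho> 0 * (1/2) ^ i)" by (intro summable_mult summable_geometric) auto
  then have sm: "summable (\<lambda>i. ?\<rho> i * cis (- (real (n i) * u)))" for u
  proof (rule summable_comparison_test'[where N = 0])
    show "norm (?\<rho> i * cis (- (real (n i) * u))) \<le> ?\<rho> 0 * (1/2) ^ i" for i
      using super_geometric_tail[of 0 i] super_geometric_bounds(1)[of i] by (simp add: norm_mult)
  qed
  have "f (t + s) - f t = (\<Sum>i. ?\<rho> i * cis (- (real (n i) * (t + s))) - ?\<rho> i * cis (- (real (n i) * t)))"
    unfolding f_def by (rule suminf_diff[OF sm sm])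
  also have "\<dots> = suminf b"
    by (intro arg_cong[where f = suminf] ext) (simp add: b_def distrib_left algebra_simps cis_mult)
  finally have eq: "f (t + s) - f t = suminf b" .
  have nb: "norm (b i) = ?\<rho> i * norm (cis (- (real (n i) * s)) - 1)" for i
    using super_geometric_bounds(1)[of i] by (simp add: b_def norm_mult)
  have "norm (suminf b - b j) \<le> (\<Sum>i<j. real (n i) * s) + 2 * (2 * ?\<rho> j ^ 3)"
  proof (rule suminf_dominant_term)
    fix i
    have "norm (cis (- (real (n i) * s)) - 1) \<le> real (n i) * s"
      using norm_cis_minus_one_le[of "- (real (n i) * s)" 0] s(1) by simp
    then show "norm (b i) \<le> real (n i) * s"
      unfolding nb using super_geometric_bounds[of i] s(1)
        mult_mono[of "?\<rho> i" 1 "norm (cis (- (real (n i) * s)) - 1)" "real (n i) * s"] by simp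
    have "norm (cis (- (real (n (i + Suc j)) * s)) - 1) \<le> 2"
      using norm_triangle_ineq4[of "cis (- (real (n (i + Suc j)) * s))" 1] by simp
    moreover have "?\<rho> (i + Suc j) \<le> ?\<rho> j ^ 3 * (1/2) ^ i"
      using super_geometric_tail[of "Suc j" i] by (simp add: super_geometric_Suc add.commute)
    ultimately have "norm (b (i + Suc j)) \<le> (?\<rho> j ^ 3 * (1/2) ^ i) * 2"
      unfolding nb using super_geometric_bounds[of j] by (intro mult_mono) auto
    then show "norm (b (i + Suc j)) \<le> 2 * ?\<rho> j ^ 3 * (1/2) ^ i" by simp
  qed
  also have "(\<Sum>i<j. real (n i) * s) \<le> ?\<rho> j ^ 3"
  proof -
    have "(\<Sum>i<j. real (n i) * s) \<le> (1 + (\<Sum>i<j. real (n i))) * s"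
      using s(1) by (simp add: sum_distrib_right distrib_right)
    also have "\<dots> \<le> ?\<rho> j ^ 4" by fact
    also have "\<dots> \<le> ?\<rho> j ^ 3" using super_geometric_bounds[of j] by (intro power_decreasing) auto
    finally show ?thesis .
  qed
  finally show ?thesis unfolding eq by (simp add: b_def)
qed

theorem theorem2:
  fixes q :: "nat \<Rightarrow> nat"
  assumes "strict_mono_on {1..} q"
    and "\<And>k. k \<ge> 1 \<Longrightarrow> q k > 0"
    and "filterlim (\<lambda>k. real (q (Suc k)) / real (q k)) at_top sequentially"
  shows "\<exists>f \<in> L0. \<not> (\<exists>g h. g \<in> PLA \<and> h \<in> L_spec {- int (q k) | k. k \<ge> 1} \<and>
                         (AE t in circle_measure. f t = g t + h t))"
proof -
  let ?\<rho> = super_geometric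
  have "\<forall>\<epsilon>. \<exists>s n. \<epsilon> > 0 \<longrightarrow> 0 < s \<and> s < \<epsilon> \<and> n \<ge> 1 \<and> 1 \<le> norm (cis (real n * s) - 1)
     \<and> (\<forall>k\<ge>1. norm (cis (real (q k) * s) - 1) \<le> \<epsilon>)"
    using shift_almost_fixing_frequencies[OF assms] by blast
  then obtain sf nf where "\<forall>\<epsilon>>0. 0 < sf \<epsilon> \<and> sf \<epsilon> < \<epsilon> \<and> nf \<epsilon> \<ge> 1
     \<and> 1 \<le> norm (cis (real (nf \<epsilon>) * sf \<epsilon>) - 1) \<and> (\<forall>k\<ge>1. norm (cis (real (q k) * sf \<epsilon>) - 1) \<le> \<epsilon>)"
    by metis
  then have sn: "0 < sf \<epsilon>" "sf \<epsilon> < \<epsilon>" "nf \<epsilon> \<ge> 1" "1 \<le> norm (cis (real (nf \<epsilon>) * sf \<epsilon>) - 1)"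
      "\<And>k. k \<ge> 1 \<Longrightarrow> norm (cis (real (q k) * sf \<epsilon>) - 1) \<le> \<epsilon>" if "\<epsilon> > 0" for \<epsilon> :: real
    using that by auto
  \<comment> \<open>The tolerance at stage \<open>j\<close> must take account of all earlier
    frequencies, so the recursion carries their running sum. Starting at 1 keeps the divisor at
    least 1 and the tolerance below \<open>?\<rho> j ^ 4\<close>.\<close>
  define A where "A = rec_nat 1 (\<lambda>j a. a + real (nf (?\<rho> j ^ 4 / a)))"
  define e where "e j = ?\<rho> j ^ 4 / A j" for j
  define n where "n j = nf (e j)" for j
  define s where "s j = sf (e j)" for j
  have A: "A j = 1 + (\<Sum>i<j. real (n i))" for j
    by (induction j) (simp_all add: A_def n_def e_def)
  have A1: "A j \<ge> 1" for j unfolding A by (simp add: sum_nonneg)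
  have epos: "e j > 0" for j using A1[of j] super_geometric_bounds[of j] by (simp add: e_def)
  have e\<rho>: "e j \<le> ?\<rho> j ^ 4" for j
    using A1[of j] super_geometric_bounds[of j] mult_left_mono[of 1 "A j" "?\<rho> j ^ 4"]
    by (simp add: e_def divide_le_eq)
  note sn' = sn[OF epos, folded n_def s_def]
  have s: "0 \<le> s j" "s j \<le> 2 * pi" "A j * s j \<le> ?\<rho> j ^ 4" for j
  proof -
    show "0 \<le> s j" using sn'(1)[of j] by simp
    have "?\<rho> j ^ 4 \<le> 1" using super_geometric_bounds[of j] by (intro power_le_one) auto
    then show "s j \<le> 2 * pi" using sn'(2)[of j] e\<rho>[of j] pi_gt3 by linarith
    have "A j * s j \<le> A j * e j" using sn'(2)[of j] A1[of j] by (intro mult_left_mono) auto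
    then show "A j * s j \<le> ?\<rho> j ^ 4" using A1[of j] by (simp add: e_def)
  qed
  define f where "f t = (\<Sum>i. ?\<rho> i * cis (- (real (n i) * t)))" for t
  have f_shift: "(\<lambda>t. f (t + a)) \<in> borel_measurable circle_measure" for a
    unfolding f_def
    by (intro borel_measurable_suminf borel_measurable_integrable integrable_circle_continuous continuous_intros)
  have f_per: "f (t + 2 * pi) = f t" for t
  proof -
    have "cis (- (real m * (t + 2 * pi))) = cis (- (real m * t))" for m
    proof -
      have "cis (- (real m * (t + 2 * pi))) = cis (- (real m * t)) * cis (2 * pi * (- real m))"
        unfolding cis_mult by (simp add: distrib_left mult_ac)
      also have "cis (2 * pi * (- real m)) = 1" by (rule cis_multiple_2pi) simp
      finally show ?thesis by simp
    qed
    then show ?thesis by (simp add: f_def)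
  qed
  have "\<not> (\<exists>g h. g \<in> PLA \<and> h \<in> L_spec {- int (q k) | k. k \<ge> 1} \<and> (AE t in circle_measure. f t = g t + h t))"
  proof (intro notI, elim exE conjE)
    fix g h assume g: "g \<in> PLA" and h: "h \<in> L_spec {- int (q k) | k. k \<ge> 1}"
      and fgh: "AE t in circle_measure. f t = g t + h t"
    let ?H = "periodic_extension h"
    obtain c where "AE t in circle_measure. (\<lambda>N. \<Sum>k<N. c k * exp (\<i> * of_nat k * of_real t)) \<longlonglongrightarrow> g t"
      using g by (auto simp: PLA_def)
    then have c: "AE t in circle_measure. (\<lambda>N. \<Sum>k<N. c k * cis t ^ k) \<longlonglongrightarrow> g t"
      unfolding exp_frequency_eq_cis .
    have conv: "AE t in circle_measure. (\<lambda>N. \<Sum>k<N. c k * cis t ^ k) \<longlonglongrightarrow> f t - ?H t"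
      using c fgh AE_periodic_extension_eq[of h] by eventually_elim simp
    obtain C where C: "\<And>\<epsilon> s. 0 < \<epsilon> \<Longrightarrow> 0 \<le> s \<Longrightarrow> s \<le> 2 * pi \<Longrightarrow> (\<And>k. k \<ge> 1 \<Longrightarrow> norm (cis (real (q k) * s) - 1) \<le> \<epsilon>)
     \<Longrightarrow> integrable circle_measure (\<lambda>t. ?H (t + s) - ?H t)
        \<and> (\<integral>t. norm (?H (t + s) - ?H t) \<partial>circle_measure) \<le> C * \<epsilon>"
      using L_spec_difference_small[OF assms h] by blast
    interpret finite_measure circle_measure by (rule finite_measure_circle_measure)
    define P where "P M = {t\<in>space circle_measure. \<exists>N. real M < norm (\<Sum>k<N. c k * cis t ^ k)}" for M :: nat
    have Pm: "P M \<in> sets circle_measure" for M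
    proof -
      have "(\<lambda>t. \<Sum>k<N. c k * cis t ^ k) \<in> borel_measurable circle_measure" for N
        by (intro borel_measurable_integrable integrable_circle_continuous continuous_intros)
      then show ?thesis unfolding P_def by measurable
    qed
    have "(\<lambda>M. measure circle_measure (P M)) \<longlonglongrightarrow> 0"
    proof (rule measure_tendsto_0_of_AE[OF Pm])
      show "AE t in circle_measure. \<forall>\<^sub>F M in sequentially. t \<notin> P M"
        using c
      proof eventually_elim
        case (elim t)
        then have "Bseq (\<lambda>N. \<Sum>k<N. c k * cis t ^ k)" by (intro convergent_imp_Bseq) (auto simp: convergent_def)
        then obtain B where B: "\<And>N. norm (\<Sum>k<N. c k * cis t ^ k) \<le> B" by (auto simp: Bseq_def)
        show ?case
          using eventually_ge_at_top[of "nat \<lceil>B\<rceil>"]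
        proof eventually_elim
          case (elim M)
          then have "B \<le> real M" by linarith
          then show ?case using B by (auto simp: P_def not_less intro: order_trans)
        qed
      qed
    qed
    then have "\<forall>\<^sub>F M in sequentially. measure circle_measure (P M) < 1/6000"
      by (rule order_tendstoD) simp
    then obtain M where "measure circle_measure (P M) < 1/6000"
      unfolding eventually_sequentially by blast
    then have EM: "measure lebesgue {t\<in>{0..2*pi}. \<exists>N. norm (\<Sum>k<N. c k * cis t ^ k) > real M} < 1/6000"
      unfolding measure_circle_measure_eq[OF Pm] by (simp add: P_def)
    \<comment> \<open>\<open>D\<close> collects the conditions on \<rho>: the final bound is
      \<open>48 * M * \<rho> + 24 * \<rho> + 8 * \<rho>\<^sup>2\<close>, with
      \<open>8 * \<rho>\<^sup>2 \<le> 4 * \<rho>\<close>, and the exceptional set of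
      \<open>h\<close> needs \<open>\<bar>C\<bar> * \<rho> < 1 / 6000\<close>. Only now, with
      \<open>M\<close> and \<open>C\<close> fixed, is \<open>j\<close> selected.\<close>
    define D where "D = 48 * real M + 32 + 6000 * \<bar>C\<bar>"
    have D: "D > 0" by (simp add: D_def add_pos_nonneg)
    have "\<forall>\<^sub>F j in sequentially. ?\<rho> j < 1 / D"
      by (rule order_tendstoD(2)[OF super_geometric_tendsto]) (use D in simp)
    then obtain j where j: "?\<rho> j < 1 / D" unfolding eventually_sequentially by blast
    define \<rho> where "\<rho> = ?\<rho> j"
    have \<rho>: "0 < \<rho>" "\<rho> \<le> 1 / 2" "\<rho> * D < 1"
      using super_geometric_bounds[of j] j D by (auto simp: \<rho>_def field_simps)
    have \<rho>D: "48 * real M * \<rho> + 32 * \<rho> + 6000 * \<bar>C\<bar> * \<rho> < 1" using \<rho>(3) by (simp add: D_def algebra_simps)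
    have \<rho>M: "48 * real M * \<rho> \<ge> 0" "6000 * \<bar>C\<bar> * \<rho> \<ge> 0" using \<rho> by auto
    have \<rho>2: "\<rho>\<^sup>2 \<le> \<rho> * (1/2)" unfolding power2_eq_square using \<rho> by (intro mult_left_mono) auto
    define v where "v t = ?H (t + s j) - ?H t" for t
    have v: "integrable circle_measure v" "(\<integral>t. norm (v t) \<partial>circle_measure) \<le> C * e j"
      using C[of "e j" "s j"] epos s sn'(5) by (auto simp: v_def[abs_def])
    have "1 \<le> 8 * \<rho>\<^sup>2 * (3 * ((2 * real M + 1) / \<rho>) + 1)"
    proof (rule power_series_key_estimate[of "s j" "n j" \<rho> "cis (- (real (n j) * s j)) - 1" "real M" c f ?H])
      show "8 * \<rho>\<^sup>2 \<le> 1" using \<rho>2 \<rho>D \<rho>M \<rho>(1) by linarith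
      have "cis (- (real (n j) * s j)) - 1 = cnj (cis (real (n j) * s j) - 1)" by (simp add: cis_cnj)
      then show "1 \<le> norm (cis (- (real (n j) * s j)) - 1)" using sn'(4)[of j] by (simp only: complex_mod_cnj)
      show "(\<lambda>t. f (t + s j) - f t) \<in> borel_measurable circle_measure"
        using f_shift[of "s j"] f_shift[of 0] by simp
      show "norm (f (t + s j) - f t - \<rho> * (cis (- (real (n j) * s j)) - 1) * cis (- (real (n j) * t))) \<le> 5 * \<rho> ^ 3" for t
        unfolding f_def \<rho>_def using s[of j] unfolding A by (intro lacunary_series_difference) auto
      show "(\<lambda>t. ?H (t + s j) - ?H t) \<in> borel_measurable circle_measure"
        using borel_measurable_integrable[OF v(1)] by (simp add: v_def[abs_def])
      \<comment> \<open>Markov's inequality at height \<rho>^3 against an integral of size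
        \<open>\<bar>C\<bar> * \<rho> ^ 4\<close> leaves the factor \<rho> that compensates the
        unknown \<open>C\<close>.\<close>
      have "measure circle_measure {t\<in>space circle_measure. norm (v t) \<ge> \<rho> ^ 3}
          \<le> (\<integral>t. norm (v t) \<partial>circle_measure) / \<rho> ^ 3"
        using v(1) \<rho> by (intro integral_Markov_inequality_measure[where A = "{}"]) auto
      also have "\<dots> \<le> (\<bar>C\<bar> * \<rho> ^ 4) / \<rho> ^ 3"
      proof (intro divide_right_mono order_trans[OF v(2)])
        have "C * e j \<le> \<bar>C\<bar> * e j" using epos[of j] by (intro mult_right_mono) auto
        also have "\<dots> \<le> \<bar>C\<bar> * \<rho> ^ 4" unfolding \<rho>_def by (intro mult_left_mono e\<rho>) auto
        finally show "C * e j \<le> \<bar>C\<bar> * \<rho> ^ 4" .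
      qed (use \<rho> in auto)
      also have "\<dots> = \<bar>C\<bar> * \<rho>" using \<rho> by (simp add: power_numeral_reduce)
      also have "\<dots> < 1/6000" using \<rho>D \<rho>M \<rho>(1) by linarith
      finally have "measure circle_measure {t\<in>space circle_measure. norm (v t) \<ge> \<rho> ^ 3} < 1/6000" .
      moreover have "measure circle_measure {t\<in>{0..2*pi}. norm (?H (t + s j) - ?H t) > \<rho> ^ 3}
          \<le> measure circle_measure {t\<in>space circle_measure. norm (v t) \<ge> \<rho> ^ 3}"
      proof (rule finite_measure_mono)
        show "{t\<in>space circle_measure. norm (v t) \<ge> \<rho> ^ 3} \<in> sets circle_measure"
          using borel_measurable_integrable[OF v(1)] by measurable
      qed (auto simp: v_def)
      ultimately show "measure circle_measure {t\<in>{0..2*pi}. norm (?H (t + s j) - ?H t) > \<rho> ^ 3} < 1/6000" by simp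
    qed (fact s sn'(3) \<rho>(1) conv f_per EM periodic_extension_periodic of_nat_0_le_iff)+
    also have "\<dots> = 24 * (2 * real M + 1) * \<rho> + 8 * \<rho>\<^sup>2"
      using \<rho> by (simp add: field_simps power2_eq_square)
    also have "\<dots> = 48 * real M * \<rho> + 24 * \<rho> + 8 * \<rho>\<^sup>2" by (simp add: algebra_simps)
    also have "\<dots> < 1" using \<rho>2 \<rho>D \<rho>M \<rho>(1) by linarith
    finally show False by simp
  qed
  moreover have "f \<in> L0" unfolding L0_def using f_shift[of 0] by simp
  ultimately show ?thesis by blast
qed

end
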